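(* Let \[\eta_0=0,\quad \eta_1=1,\quad \eta_2=\sqrt{\tfrac43},\quad \eta_3=\tfrac{1+\sqrt2}{2},\quad \eta_4=\tfrac1{15}\sqrt{169+38\sqrt{19}},\quad \eta_5=\sqrt{\tfrac32},\quad \eta_6=\tfrac25\sqrt{5+2\sqrt5},\] so that $\eta_0<\eta_1<\dots<\eta_6$. Let $\mathcal N$ be the set of all finite Schur norms $\|A\|_\bullet$ of infinite matrices $A=[a_{ij}]_{i,j\in\mathbb N}$ with every $a_{ij}\in\{0,1\}$ (i.e. the set of norms of all bounded idempotent Schur multipliers on $\mathcal B(\ell^2)$). Then \[\{\eta_0,\eta_1,\eta_2,\eta_3,\eta_4,\eta_5,\eta_6\}\subseteq \mathcal N\subseteq \{\eta_0,\eta_1,\eta_2,\eta_3,\eta_4,\eta_5\}\cup[\eta_6,\infty).\] In particular each open interval $(\eta_{j-1},\eta_j)$, $1\le j\le 6$, is disjoint from $\mathcal N$.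
   Context: Fix $\mathbb F\in\{\mathbb R,\mathbb C\}$. For $m,n\in\mathbb N\cup\{\aleph_0\}$, let $\mathcal B=\mathcal B(\ell^2_n,\ell^2_m)$ be the space of $m\times n$ matrices with entries in $\mathbb F$ defining bounded operators $\ell^2_n\to\ell^2_m$ (with operator norm). For an $m\times n$ matrix $A$, the Schur (entrywise) product is $A\bullet X=[a_{ij}x_{ij}]$, and the Schur norm is $\|A\|_\bullet=\sup\{\|A\bullet X\|:X\in\mathcal B,\ \|X\|\le 1\}\in[0,\infty]$ (for infinite matrices, $\|A\|_\bullet=\infty$ if $A\bullet X$ fails to be bounded for some $X\in\mathcal B$; equivalently $\|A\|_\bullet$ is the supremum of the Schur norms of its finite upper-left corners). $A$ is a (bounded) Schur multiplier if $\|A\|_\bullet<\infty$. *)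

theory Defs
  imports "HOL-Analysis.Analysis"
begin

text \<open>Finite matrices/vectors are represented as functions on nat, of which only
the indices below the given size are used. Scalars range over a real normed field
(instantiated below with real and with complex).\<close>

definition l2norm :: "nat \<Rightarrow> (nat \<Rightarrow> 'a::real_normed_field) \<Rightarrow> real" where
  "l2norm n x = sqrt (\<Sum>i<n. (norm (x i))^2)"

definition mat_apply :: "nat \<Rightarrow> nat \<Rightarrow> (nat \<Rightarrow> nat \<Rightarrow> 'a::real_normed_field) \<Rightarrow> (nat \<Rightarrow> 'a) \<Rightarrow> (nat \<Rightarrow> 'a)" where
  "mat_apply m n A x = (\<lambda>i. if i < m then (\<Sum>j<n. A i j * x j) else 0)"

definition op_norm :: "nat \<Rightarrow> nat \<Rightarrow> (nat \<Rightarrow> nat \<Rightarrow> 'a::real_normed_field) \<Rightarrow> real" where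
  "op_norm m n A = Sup {l2norm m (mat_apply m n A x) | x. l2norm n x \<le> 1}"

definition schur_prod :: "(nat \<Rightarrow> nat \<Rightarrow> 'a::real_normed_field) \<Rightarrow> (nat \<Rightarrow> nat \<Rightarrow> 'a) \<Rightarrow> (nat \<Rightarrow> nat \<Rightarrow> 'a)" where
  "schur_prod A X = (\<lambda>i j. A i j * X i j)"

definition schur_norm_fin :: "nat \<Rightarrow> (nat \<Rightarrow> nat \<Rightarrow> 'a::real_normed_field) \<Rightarrow> real" where
  "schur_norm_fin n A = Sup {op_norm n n (schur_prod A X) | X. op_norm n n X \<le> 1}"

definition schur_norm :: "(nat \<Rightarrow> nat \<Rightarrow> 'a::real_normed_field) \<Rightarrow> ereal" where
  "schur_norm A = (SUP n. ereal (schur_norm_fin n A))"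

definition idem_schur_norms :: "'a::real_normed_field itself \<Rightarrow> real set" where
  "idem_schur_norms _ = {real_of_ereal (schur_norm A) | A :: nat \<Rightarrow> nat \<Rightarrow> 'a.
      (\<forall>i j. A i j \<in> {0, 1}) \<and> schur_norm A < \<infinity>}"


end

theory Submission
  imports Defs
begin

text \<open>
  A 0-1 matrix is the biadjacency relation of a bipartite graph. Writing its entries as inner
  products of vectors of squared length at most \<open>t\<close> bounds the Schur norm by \<open>t\<close>; a real contraction
  supported on a finite submatrix, together with a test vector, bounds it from below. Eight small
  graphs have norm at least \<open>\<eta>\<^sub>6\<close>: the \<open>3 \<times> 3\<close> staircase, the 4-cycle pair sharing an edge, the
  6-cycle, the path \<open>P\<^sub>8\<close>, three spiders (trees with one branching vertex, named by their leg lengths)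
  and a tree with two adjacent branching vertices. Once twins, i.e. equal rows or equal columns, are
  identified, a graph without these induced subgraphs has no 4-cycles and no 6-cycles and has degrees
  at most 3. A component with a vertex of degree 3 is an induced subgraph of the spider 133 (norm \<open>\<eta>\<^sub>4\<close>)
  or equals the spider 222 (norm \<open>\<eta>\<^sub>5\<close>), and every other one is a path with at most 7 vertices or an
  8-cycle, of norm 1, \<open>\<eta>\<^sub>2\<close> or \<open>\<eta>\<^sub>3\<close>. The norm of the whole matrix is the largest norm of a component.
\<close>

subsection \<open>Operator norms and Schur norms of finite matrices\<close>

lemma l2norm_nonneg [simp]: "0 \<le> l2norm n x"
  by (simp add: l2norm_def sum_nonneg)

lemma l2norm_power2: "(l2norm n x)\<^sup>2 = (\<Sum>i<n. (norm (x i))\<^sup>2)"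
  by (simp add: l2norm_def sum_nonneg)

lemma l2norm_mat_apply_power2:
  "(l2norm m (mat_apply m n A x))\<^sup>2 = (\<Sum>i<m. (norm (\<Sum>j<n. A i j * x j))\<^sup>2)"
  by (simp add: l2norm_power2 mat_apply_def)

lemma l2norm_scale: "l2norm n (\<lambda>i. a * x i) = norm a * l2norm n x"
  by (simp add: l2norm_def norm_mult power_mult_distrib real_sqrt_mult flip: sum_distrib_left)

lemma mat_apply_scale: "mat_apply m n A (\<lambda>i. a * x i) = (\<lambda>i. a * mat_apply m n A x i)"
  by (auto simp: mat_apply_def sum_distrib_left ac_simps fun_eq_iff)

lemma norm_le_l2norm:
  assumes "i < n"
  shows "norm (x i) \<le> l2norm n x"
proof -
  have "(norm (x i))\<^sup>2 \<le> (\<Sum>i<n. (norm (x i))\<^sup>2)"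
    using assms by (intro member_le_sum) auto
  then show ?thesis
    unfolding l2norm_def by (rule real_le_rsqrt)
qed

lemma l2norm_le_sum: "l2norm n x \<le> (\<Sum>i<n. norm (x i))"
  unfolding l2norm_def using L2_set_le_sum[of "{..<n}" "\<lambda>i. norm (x i)"]
  by (simp add: L2_set_def)

text \<open>A crude bound: it keeps the sets whose suprema define the norms bounded, and it settles
  vectors of norm zero.\<close>

lemma l2norm_mat_apply_le_entries:
  "l2norm m (mat_apply m n A x) \<le> (\<Sum>i<m. \<Sum>j<n. norm (A i j)) * l2norm n x"
proof -
  have "l2norm m (mat_apply m n A x) \<le> (\<Sum>i<m. norm (\<Sum>j<n. A i j * x j))"
    using l2norm_le_sum[of m "mat_apply m n A x"] by (simp add: mat_apply_def)
  also have "\<dots> \<le> (\<Sum>i<m. \<Sum>j<n. norm (A i j) * l2norm n x)"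
    by (intro sum_mono order_trans[OF norm_sum])
      (auto simp: norm_mult intro!: mult_left_mono norm_le_l2norm)
  finally show ?thesis
    by (simp add: sum_distrib_right)
qed

lemma op_norm_le:
  assumes "\<And>x. l2norm n x \<le> 1 \<Longrightarrow> l2norm m (mat_apply m n A x) \<le> K"
  shows "op_norm m n A \<le> K"
  unfolding op_norm_def
proof (rule cSup_least)
  have "l2norm n (\<lambda>_. 0) \<le> 1"
    by (simp add: l2norm_def)
  then show "{l2norm m (mat_apply m n A x) |x. l2norm n x \<le> 1} \<noteq> {}"
    by blast
qed (use assms in blast)

lemma l2norm_mat_apply_le_op_norm:
  "l2norm m (mat_apply m n A x) \<le> op_norm m n A * l2norm n x"
proof (cases "l2norm n x = 0")
  case True
  then show ?thesis
    using l2norm_mat_apply_le_entries[of m n A x] by simp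
next
  case False
  define L where "L = l2norm n x"
  have L: "L > 0"
    using False l2norm_nonneg[of n x] unfolding L_def by linarith
  let ?y = "\<lambda>i. of_real (inverse L) * x i"
  have y: "l2norm n ?y \<le> 1"
    using L unfolding l2norm_scale by (simp add: norm_inverse flip: L_def)
  have bdd: "bdd_above {l2norm m (mat_apply m n A x) |x. l2norm n x \<le> 1}"
  proof (rule bdd_aboveI, safe)
    fix z :: "nat \<Rightarrow> 'a" assume "l2norm n z \<le> 1"
    then show "l2norm m (mat_apply m n A z) \<le> (\<Sum>i<m. \<Sum>j<n. norm (A i j))"
      by (intro order_trans[OF l2norm_mat_apply_le_entries] mult_left_le) (auto intro!: sum_nonneg)
  qed
  have "l2norm m (mat_apply m n A ?y) \<le> op_norm m n A"
    unfolding op_norm_def by (rule cSup_upper[OF _ bdd]) (use y in blast)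
  moreover have "l2norm m (mat_apply m n A ?y) = inverse L * l2norm m (mat_apply m n A x)"
    using L unfolding mat_apply_scale l2norm_scale by (simp add: norm_inverse)
  ultimately have "inverse L * l2norm m (mat_apply m n A x) \<le> op_norm m n A"
    by simp
  then show ?thesis
    using L by (simp add: field_simps flip: L_def)
qed

text \<open>Apply \<open>X\<close> to a coordinate vector. Entries of a contraction thus have
  modulus at most 1, which bounds the set defining \<open>schur_norm_fin\<close>.\<close>

lemma entry_le_op_norm:
  assumes "i < m" "j < n"
  shows "norm (X i j) \<le> op_norm m n X"
proof -
  let ?e = "\<lambda>k. of_bool (k = j) :: 'a"
  have e: "l2norm n ?e = 1"
    using assms(2) by (simp add: l2norm_def of_bool_def if_distrib[of norm] if_distrib[of "\<lambda>z. z\<^sup>2"] cong: if_cong)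
  have "norm (X i j) = norm (mat_apply m n X ?e i)"
    using assms by (simp add: mat_apply_def)
  also have "\<dots> \<le> l2norm m (mat_apply m n X ?e)"
    using assms(1) by (rule norm_le_l2norm)
  also have "\<dots> \<le> op_norm m n X"
    using l2norm_mat_apply_le_op_norm[of m n X ?e] by (simp only: e mult_1_right)
  finally show ?thesis .
qed

lemma schur_norm_fin_le:
  assumes "\<And>X. op_norm n n X \<le> 1 \<Longrightarrow> op_norm n n (schur_prod A X) \<le> K"
  shows "schur_norm_fin n A \<le> K"
  unfolding schur_norm_fin_def
proof (rule cSup_least)
  have "op_norm n n (\<lambda>_ _. 0::'a) \<le> 1"
    by (rule op_norm_le) (simp add: mat_apply_def l2norm_def)
  then show "{op_norm n n (schur_prod A X) |X. op_norm n n X \<le> 1} \<noteq> {}"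
    by blast
qed (use assms in blast)

lemma op_norm_schur_prod_le_schur_norm_fin:
  assumes "op_norm n n X \<le> 1"
  shows "op_norm n n (schur_prod A X) \<le> schur_norm_fin n A"
proof -
  have "bdd_above {op_norm n n (schur_prod A X) |X. op_norm n n X \<le> 1}"
  proof (rule bdd_aboveI, safe)
    fix X :: "nat \<Rightarrow> nat \<Rightarrow> 'a" assume X: "op_norm n n X \<le> 1"
    show "op_norm n n (schur_prod A X) \<le> (\<Sum>i<n. \<Sum>j<n. norm (A i j))"
    proof (rule op_norm_le)
      fix x :: "nat \<Rightarrow> 'a" assume x: "l2norm n x \<le> 1"
      have "l2norm n (mat_apply n n (schur_prod A X) x)
          \<le> (\<Sum>i<n. \<Sum>j<n. norm (schur_prod A X i j)) * l2norm n x"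
        by (rule l2norm_mat_apply_le_entries)
      also have "\<dots> \<le> (\<Sum>i<n. \<Sum>j<n. norm (schur_prod A X i j))"
        using x by (intro mult_left_le) (auto intro!: sum_nonneg)
      also have "\<dots> \<le> (\<Sum>i<n. \<Sum>j<n. norm (A i j))"
        unfolding schur_prod_def norm_mult
        by (intro sum_mono mult_left_le order_trans[OF entry_le_op_norm X]) auto
      finally show "l2norm n (mat_apply n n (schur_prod A X) x) \<le> (\<Sum>i<n. \<Sum>j<n. norm (A i j))" .
    qed
  qed
  then show ?thesis
    unfolding schur_norm_fin_def by (rule cSup_upper[rotated]) (use assms in blast)
qed

subsection \<open>Factorisations bound the Schur norm from above\<close>

text \<open>The Grothendieck-Haagerup criterion for Schur multipliers, with real vectors in a finite
  dimension \<open>N\<close>. The sets \<open>S\<close> and \<open>T\<close> may be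
  infinite.\<close>

definition factorable :: "('r \<Rightarrow> 'c \<Rightarrow> bool) \<Rightarrow> real \<Rightarrow> 'r set \<Rightarrow> 'c set \<Rightarrow> bool" where
  "factorable E t S T \<longleftrightarrow> (\<exists>(N::nat) x y.
     (\<forall>r\<in>S. (\<Sum>k<N. (x r k)\<^sup>2) \<le> t) \<and> (\<forall>c\<in>T. (\<Sum>k<N. (y c k)\<^sup>2) \<le> t) \<and>
     (\<forall>r\<in>S. \<forall>c\<in>T. (\<Sum>k<N. x r k * y c k) = (of_bool (E r c) :: real)))"

lemma norm_sum_of_real_mult_power2_le:
  fixes z :: "nat \<Rightarrow> 'a::real_normed_field"
  shows "(norm (\<Sum>k<N. of_real (a k) * z k))\<^sup>2 \<le> (\<Sum>k<N. (a k)\<^sup>2) * (\<Sum>k<N. (norm (z k))\<^sup>2)"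
proof -
  have "(norm (\<Sum>k<N. of_real (a k) * z k))\<^sup>2 \<le> (\<Sum>k<N. \<bar>a k\<bar> * norm (z k))\<^sup>2"
    by (intro power_mono order_trans[OF norm_sum]) (auto simp: norm_mult)
  also have "\<dots> \<le> (\<Sum>k<N. \<bar>a k\<bar>\<^sup>2) * (\<Sum>k<N. (norm (z k))\<^sup>2)"
    by (rule Cauchy_Schwarz_ineq_sum)
  finally show ?thesis by simp
qed

text \<open>The factorisation writes the Schur product as a sum over \<open>k\<close> of
  \<open>X\<close> between two diagonal matrices. Cauchy-Schwarz in \<open>k\<close> costs one
  factor \<open>t\<close> for the rows; contractivity of \<open>X\<close> on each \<open>z k\<close>
  leaves a second one for the columns.\<close>

lemma schur_norm_fin_le_factorable:
  fixes A :: "nat \<Rightarrow> nat \<Rightarrow> 'a::real_normed_field"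
  assumes A: "\<And>i j. A i j = of_bool (E i j)" and t: "0 \<le> t"
    and fac: "factorable E t {..<n} {..<n}"
  shows "schur_norm_fin n A \<le> t"
proof (rule schur_norm_fin_le)
  fix X :: "nat \<Rightarrow> nat \<Rightarrow> 'a" assume X: "op_norm n n X \<le> 1"
  obtain N :: nat and x y where
    x: "\<And>i. i < n \<Longrightarrow> (\<Sum>k<N. (x i k)\<^sup>2) \<le> t" and y: "\<And>j. j < n \<Longrightarrow> (\<Sum>k<N. (y j k)\<^sup>2) \<le> t"
    and xy: "\<And>i j. i < n \<Longrightarrow> j < n \<Longrightarrow> (\<Sum>k<N. x i k * y j k) = (of_bool (E i j) :: real)"
    using fac unfolding factorable_def Ball_def lessThan_iff by blast
  have contr: "(l2norm n (mat_apply n n X z))\<^sup>2 \<le> (l2norm n z)\<^sup>2" for z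
    using mult_right_mono[OF X l2norm_nonneg, of n z] l2norm_mat_apply_le_op_norm[of n n X z]
    by (intro power_mono) auto
  show "op_norm n n (schur_prod A X) \<le> t"
  proof (rule op_norm_le)
    fix v :: "nat \<Rightarrow> 'a" assume v: "l2norm n v \<le> 1"
    define z where "z k j = of_real (y j k) * v j" for k j
    have eq: "(\<Sum>j<n. schur_prod A X i j * v j) = (\<Sum>k<N. of_real (x i k) * (\<Sum>j<n. X i j * z k j))"
      if "i < n" for i
    proof -
      have "(\<Sum>j<n. schur_prod A X i j * v j) = (\<Sum>j<n. of_real (\<Sum>k<N. x i k * y j k) * X i j * v j)"
        using that by (intro sum.cong) (auto simp: schur_prod_def A xy)
      also have "\<dots> = (\<Sum>j<n. \<Sum>k<N. of_real (x i k) * (X i j * z k j))"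
        by (simp add: z_def sum_distrib_left sum_distrib_right ac_simps)
      also have "\<dots> = (\<Sum>k<N. \<Sum>j<n. of_real (x i k) * (X i j * z k j))"
        by (rule sum.swap)
      finally show ?thesis
        by (simp add: sum_distrib_left)
    qed
    have "(l2norm n (mat_apply n n (schur_prod A X) v))\<^sup>2
        = (\<Sum>i<n. (norm (\<Sum>k<N. of_real (x i k) * (\<Sum>j<n. X i j * z k j)))\<^sup>2)"
      unfolding l2norm_mat_apply_power2 using eq by (intro sum.cong) auto
    also have "\<dots> \<le> (\<Sum>i<n. t * (\<Sum>k<N. (norm (\<Sum>j<n. X i j * z k j))\<^sup>2))"
      by (intro sum_mono order_trans[OF norm_sum_of_real_mult_power2_le] mult_right_mono x)
        (auto intro!: sum_nonneg)
    also have "\<dots> = t * (\<Sum>k<N. (l2norm n (mat_apply n n X (z k)))\<^sup>2)"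
      unfolding l2norm_mat_apply_power2 sum_distrib_left by (rule sum.swap)
    also have "\<dots> \<le> t * (\<Sum>k<N. (l2norm n (z k))\<^sup>2)"
      using t by (intro mult_left_mono sum_mono contr)
    also have "(\<Sum>k<N. (l2norm n (z k))\<^sup>2) = (\<Sum>j<n. (\<Sum>k<N. (y j k)\<^sup>2) * (norm (v j))\<^sup>2)"
      unfolding l2norm_power2 z_def norm_mult power_mult_distrib sum_distrib_right
      by (subst sum.swap) simp
    also have "\<dots> \<le> (\<Sum>j<n. t * (norm (v j))\<^sup>2)"
      by (intro sum_mono mult_right_mono y) auto
    also have "\<dots> = t * (l2norm n v)\<^sup>2"
      by (simp add: l2norm_power2 sum_distrib_left)
    also have "\<dots> \<le> t * 1"
      using t v by (intro mult_left_mono power_le_one) auto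
    finally have "(l2norm n (mat_apply n n (schur_prod A X) v))\<^sup>2 \<le> t\<^sup>2"
      using t by (simp add: power2_eq_square mult_left_mono)
    then show "l2norm n (mat_apply n n (schur_prod A X) v) \<le> t"
      using t by (rule power2_le_imp_le)
  qed
qed

lemma factorable_empty: "0 \<le> t \<Longrightarrow> factorable E t {} T"
  unfolding factorable_def by (intro exI[of _ 0]) auto

lemma factorable_mono:
  assumes "factorable E t S T" "t \<le> t'" "S' \<subseteq> S" "T' \<subseteq> T"
  shows "factorable E t' S' T'"
proof -
  obtain N :: nat and x y where
    "\<forall>r\<in>S. (\<Sum>k<N. (x r k)\<^sup>2) \<le> t" "\<forall>c\<in>T. (\<Sum>k<N. (y c k)\<^sup>2) \<le> t"
    "\<forall>r\<in>S. \<forall>c\<in>T. (\<Sum>k<N. x r k * y c k) = (of_bool (E r c) :: real)"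
    using assms(1) unfolding factorable_def by blast
  then show ?thesis
    using assms(2-4) unfolding factorable_def
    by (intro exI[of _ N] exI[of _ x] exI[of _ y] conjI) (meson order_trans subsetD)+
qed

lemma factorable_transp:
  assumes "factorable (\<lambda>c r. E r c) t T S"
  shows "factorable E t S T"
proof -
  obtain N :: nat and x y where
    "\<forall>c\<in>T. (\<Sum>k<N. (x c k)\<^sup>2) \<le> t" "\<forall>r\<in>S. (\<Sum>k<N. (y r k)\<^sup>2) \<le> t"
    "\<forall>c\<in>T. \<forall>r\<in>S. (\<Sum>k<N. x c k * y r k) = (of_bool (E r c) :: real)"
    using assms unfolding factorable_def by blast
  then show ?thesis
    unfolding factorable_def
    by (intro exI[of _ N] exI[of _ y] exI[of _ x]) (simp add: mult.commute)
qed

text \<open>The maps may identify indices: twins share a vector.\<close>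

lemma factorable_vimage:
  assumes "factorable E t (f ` S) (g ` T)"
  shows "factorable (\<lambda>r c. E (f r) (g c)) t S T"
proof -
  obtain N :: nat and x y where *: "\<forall>r\<in>S. (\<Sum>k<N. (x (f r) k)\<^sup>2) \<le> t" "\<forall>c\<in>T. (\<Sum>k<N. (y (g c) k)\<^sup>2) \<le> t"
     "\<forall>r\<in>S. \<forall>c\<in>T. (\<Sum>k<N. x (f r) k * y (g c) k) = (of_bool (E (f r) (g c)) :: real)"
    using assms unfolding factorable_def by auto
  then show ?thesis
    unfolding factorable_def
    by (intro exI[of _ N] exI[of _ "\<lambda>r. x (f r)"] exI[of _ "\<lambda>c. y (g c)"]) auto
qed

lemma sum_shift_split: "(\<Sum>k<M+N. f k) = (\<Sum>k<M. f k) + (\<Sum>k<N. f (M + k))" for M N :: nat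
  by (induction N) (simp_all add: add.assoc)

text \<open>The two families are put into orthogonal blocks of coordinates, so the cross inner
  products vanish, as the missing cross edges demand.\<close>

lemma factorable_Un:
  assumes t: "0 \<le> t" and f1: "factorable E t S1 T1" and f2: "factorable E t S2 T2"
    and disj: "S1 \<inter> S2 = {}" "T1 \<inter> T2 = {}"
    and cross: "\<And>r c. r \<in> S1 \<Longrightarrow> c \<in> T2 \<Longrightarrow> \<not> E r c" "\<And>r c. r \<in> S2 \<Longrightarrow> c \<in> T1 \<Longrightarrow> \<not> E r c"
  shows "factorable E t (S1 \<union> S2) (T1 \<union> T2)"
proof -
  obtain M :: nat and x1 y1 where 1: "\<And>r. r\<in>S1 \<Longrightarrow> (\<Sum>k<M. (x1 r k)\<^sup>2) \<le> t" "\<And>c. c\<in>T1 \<Longrightarrow> (\<Sum>k<M. (y1 c k)\<^sup>2) \<le> t"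
     "\<And>r c. r\<in>S1 \<Longrightarrow> c\<in>T1 \<Longrightarrow> (\<Sum>k<M. x1 r k * y1 c k) = (of_bool (E r c) :: real)"
    using f1 unfolding factorable_def by blast
  obtain N :: nat and x2 y2 where 2: "\<And>r. r\<in>S2 \<Longrightarrow> (\<Sum>k<N. (x2 r k)\<^sup>2) \<le> t" "\<And>c. c\<in>T2 \<Longrightarrow> (\<Sum>k<N. (y2 c k)\<^sup>2) \<le> t"
     "\<And>r c. r\<in>S2 \<Longrightarrow> c\<in>T2 \<Longrightarrow> (\<Sum>k<N. x2 r k * y2 c k) = (of_bool (E r c) :: real)"
    using f2 unfolding factorable_def by blast
  define x where "x r k = (if r \<in> S1 then (if k < M then x1 r k else 0) else (if k < M then 0 else x2 r (k - M)))" for r k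
  define y where "y r k = (if r \<in> T1 then (if k < M then y1 r k else 0) else (if k < M then 0 else y2 r (k - M)))" for r k
  show ?thesis
    unfolding factorable_def
  proof (intro exI conjI ballI)
    show "(\<Sum>k<M+N. (x r k)\<^sup>2) \<le> t" if "r \<in> S1 \<union> S2" for r
      using that 1(1) 2(1) disj by (cases "r \<in> S1") (auto simp: x_def sum_shift_split)
    show "(\<Sum>k<M+N. (y r k)\<^sup>2) \<le> t" if "r \<in> T1 \<union> T2" for r
      using that 1(2) 2(2) disj by (cases "r \<in> T1") (auto simp: y_def sum_shift_split)
    show "(\<Sum>k<M+N. x r k * y c k) = of_bool (E r c)" if "r \<in> S1 \<union> S2" "c \<in> T1 \<union> T2" for r c
      using that 1(3) 2(3) disj cross
      by (cases "r \<in> S1"; cases "c \<in> T1") (auto simp: x_def y_def sum_shift_split)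
  qed
qed

text \<open>The weights and the unequal bounds keep square roots out of the explicit factorisations.\<close>

lemma factorable_weighted:
  fixes w :: "nat \<Rightarrow> real"
  assumes w: "\<And>k. k < N \<Longrightarrow> 0 \<le> w k" and t: "0 < t" and \<alpha>: "0 < \<alpha>" and \<alpha>\<beta>: "\<alpha> * \<beta> \<le> t\<^sup>2"
    and x: "\<And>r. r \<in> S \<Longrightarrow> (\<Sum>k<N. w k * (x r k)\<^sup>2) \<le> \<alpha>"
    and y: "\<And>c. c \<in> T \<Longrightarrow> (\<Sum>k<N. w k * (y c k)\<^sup>2) \<le> \<beta>"
    and xy: "\<And>r c. r \<in> S \<Longrightarrow> c \<in> T \<Longrightarrow> (\<Sum>k<N. w k * x r k * y c k) = of_bool (E r c)"
  shows "factorable E t S T"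
  unfolding factorable_def
proof (intro exI conjI ballI)
  \<comment> \<open>The two outer roots balance the bounds \<alpha> and \<beta> and cancel in inner
    products.\<close>
  let ?x = "\<lambda>r k. sqrt (t / \<alpha>) * sqrt (w k) * x r k"
  let ?y = "\<lambda>c k. sqrt (\<alpha> / t) * sqrt (w k) * y c k"
  show "(\<Sum>k<N. (?x r k)\<^sup>2) \<le> t" if "r \<in> S" for r
  proof -
    have "(\<Sum>k<N. (?x r k)\<^sup>2) = (\<Sum>k<N. t / \<alpha> * (w k * (x r k)\<^sup>2))"
      using w t \<alpha> by (intro sum.cong) (auto simp: power_mult_distrib)
    also have "\<dots> = t / \<alpha> * (\<Sum>k<N. w k * (x r k)\<^sup>2)"
      by (simp only: sum_distrib_left)
    also have "\<dots> \<le> t / \<alpha> * \<alpha>"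
      using x[OF that] t \<alpha> by (intro mult_left_mono) auto
    finally show ?thesis using \<alpha> by simp
  qed
  show "(\<Sum>k<N. (?y c k)\<^sup>2) \<le> t" if "c \<in> T" for c
  proof -
    have "(\<Sum>k<N. (?y c k)\<^sup>2) = (\<Sum>k<N. \<alpha> / t * (w k * (y c k)\<^sup>2))"
      using w t \<alpha> by (intro sum.cong) (auto simp: power_mult_distrib)
    also have "\<dots> = \<alpha> / t * (\<Sum>k<N. w k * (y c k)\<^sup>2)"
      by (simp only: sum_distrib_left)
    also have "\<dots> \<le> \<alpha> / t * \<beta>"
      using y[OF that] t \<alpha> by (intro mult_left_mono) auto
    also have "\<dots> \<le> t"
      using \<alpha>\<beta> t by (simp add: field_simps power2_eq_square)
    finally show ?thesis .
  qed
  show "(\<Sum>k<N. ?x r k * ?y c k) = of_bool (E r c)" if "r \<in> S" "c \<in> T" for r c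
  proof -
    have "sqrt (t / \<alpha>) * sqrt (\<alpha> / t) = 1"
      using t \<alpha> by (simp flip: real_sqrt_mult)
    then have "?x r k * ?y c k = w k * x r k * y c k" if "k < N" for k
      using w[OF that] by (simp add: algebra_simps)
    then have "(\<Sum>k<N. ?x r k * ?y c k) = (\<Sum>k<N. w k * x r k * y c k)"
      by (intro sum.cong) (simp_all only: lessThan_iff)
    then show ?thesis
      using xy[OF that] by (simp only:)
  qed
qed

subsection \<open>Contractions bound the Schur norm from below\<close>

definition contraction :: "nat \<Rightarrow> nat \<Rightarrow> (nat \<Rightarrow> nat \<Rightarrow> real) \<Rightarrow> bool" where
  "contraction p q X \<longleftrightarrow> (\<forall>v. (\<Sum>i<p. (\<Sum>j<q. X i j * v j)\<^sup>2) \<le> (\<Sum>j<q. (v j)\<^sup>2))"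

text \<open>Squares and real entries make one certificate serve both scalar fields. The injections
  let a pattern sit anywhere in \<open>E\<close>, in any order.\<close>

definition schur_lower :: "('r \<Rightarrow> 'c \<Rightarrow> bool) \<Rightarrow> real \<Rightarrow> bool" where
  "schur_lower E t \<longleftrightarrow> (\<exists>p q \<rho> \<gamma> X v. inj_on \<rho> {..<p} \<and> inj_on \<gamma> {..<q} \<and> contraction p q X \<and>
     0 < (\<Sum>j<q. (v j)\<^sup>2) \<and>
     t\<^sup>2 * (\<Sum>j<q. (v j)\<^sup>2) \<le> (\<Sum>i<p. (\<Sum>j<q. of_bool (E (\<rho> i) (\<gamma> j)) * X i j * v j)\<^sup>2))"

text \<open>Cauchy-Schwarz after moving the matrix to the other side of the inner product; this
  carries estimates over to the transpose.\<close>

lemma bilinear_swap_power2_le: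
  fixes M :: "nat \<Rightarrow> nat \<Rightarrow> real"
  shows "(\<Sum>i<p. u i * (\<Sum>j<q. M i j * v j))\<^sup>2 \<le> (\<Sum>j<q. (\<Sum>i<p. M i j * u i)\<^sup>2) * (\<Sum>j<q. (v j)\<^sup>2)"
proof -
  have "(\<Sum>i<p. u i * (\<Sum>j<q. M i j * v j)) = (\<Sum>j<q. (\<Sum>i<p. M i j * u i) * v j)"
    unfolding sum_distrib_left sum_distrib_right by (subst sum.swap) (simp add: ac_simps)
  then show ?thesis
    by (simp add: Cauchy_Schwarz_ineq_sum)
qed

lemma contraction_transp:
  assumes "contraction p q X"
  shows "contraction q p (\<lambda>j i. X i j)"
  unfolding contraction_def
proof
  fix u
  define z where "z j = (\<Sum>i<p. X i j * u i)" for j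
  define Z where "Z = (\<Sum>j<q. (z j)\<^sup>2)"
  \<comment> \<open>\<open>Z\<close> is the inner product of \<open>u\<close> with the image of
    \<open>z\<close> under \<open>X\<close>. Contractivity bounds its square by \<open>Z\<close>
    times the squared norm of \<open>u\<close>, and a factor \<open>Z\<close> cancels.\<close>
  have "Z = (\<Sum>j<q. z j * (\<Sum>i<p. X i j * u i))"
    by (simp add: Z_def z_def power2_eq_square)
  then have "Z\<^sup>2 \<le> (\<Sum>i<p. (\<Sum>j<q. X i j * z j)\<^sup>2) * (\<Sum>i<p. (u i)\<^sup>2)"
    using bilinear_swap_power2_le[of z "\<lambda>j i. X i j" u p q] by simp
  also have "\<dots> \<le> Z * (\<Sum>i<p. (u i)\<^sup>2)"
    using assms unfolding contraction_def Z_def by (intro mult_right_mono sum_nonneg) auto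
  finally have "Z * Z \<le> Z * (\<Sum>i<p. (u i)\<^sup>2)"
    by (simp add: power2_eq_square)
  moreover have "0 \<le> Z" "0 \<le> (\<Sum>i<p. (u i)\<^sup>2)"
    by (simp_all add: Z_def sum_nonneg)
  ultimately have "Z \<le> (\<Sum>i<p. (u i)\<^sup>2)"
    by (cases "Z = 0") auto
  then show "(\<Sum>j<q. (\<Sum>i<p. X i j * u i)\<^sup>2) \<le> (\<Sum>i<p. (u i)\<^sup>2)"
    by (simp add: Z_def z_def)
qed

text \<open>The image \<open>w\<close> of the test vector is the test vector for the transpose; it
  is nonzero because \<open>t\<close> is positive.\<close>

lemma schur_lower_transp:
  assumes "schur_lower (\<lambda>c r. E r c) t" and t: "0 < t"
  shows "schur_lower E t"
proof -
  obtain p q \<rho> \<gamma> X v where inj: "inj_on \<rho> {..<p}" "inj_on \<gamma> {..<q}" and X: "contraction p q X"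
    and v: "0 < (\<Sum>j<q. (v j)\<^sup>2)"
    and le: "t\<^sup>2 * (\<Sum>j<q. (v j)\<^sup>2) \<le> (\<Sum>i<p. (\<Sum>j<q. of_bool (E (\<gamma> j) (\<rho> i)) * X i j * v j)\<^sup>2)"
    using assms(1) unfolding schur_lower_def by blast
  define M :: "nat \<Rightarrow> nat \<Rightarrow> real" where "M i j = of_bool (E (\<gamma> j) (\<rho> i)) * X i j" for i j
  define w where "w i = (\<Sum>j<q. M i j * v j)" for i
  define V where "V = (\<Sum>j<q. (v j)\<^sup>2)"
  define L where "L = (\<Sum>i<p. (w i)\<^sup>2)"
  have V: "V > 0" and L: "t\<^sup>2 * V \<le> L"
    using v le by (simp_all add: V_def L_def w_def M_def)
  have "t\<^sup>2 * V > 0"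
    using V t by simp
  then have "L > 0"
    using L by simp
  have "L = (\<Sum>i<p. w i * (\<Sum>j<q. M i j * v j))"
    by (simp add: L_def w_def power2_eq_square)
  then have "L\<^sup>2 \<le> (\<Sum>j<q. (\<Sum>i<p. M i j * w i)\<^sup>2) * V"
    using bilinear_swap_power2_le[of w M v q p] by (simp add: V_def)
  moreover have "t\<^sup>2 * L * V \<le> L\<^sup>2"
    using mult_right_mono[OF L, of L] \<open>L > 0\<close> by (simp add: power2_eq_square ac_simps)
  ultimately have "t\<^sup>2 * L * V \<le> (\<Sum>j<q. (\<Sum>i<p. M i j * w i)\<^sup>2) * V"
    by linarith
  then have "t\<^sup>2 * L \<le> (\<Sum>j<q. (\<Sum>i<p. M i j * w i)\<^sup>2)"
    using V by simp
  with \<open>L > 0\<close> show ?thesis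
    unfolding schur_lower_def L_def M_def
    using inj contraction_transp[OF X] by blast
qed

text \<open>A real matrix acts on each real coordinate of the scalars separately, so a real
  contraction remains one over the complex numbers.\<close>

lemma contraction_euclidean:
  fixes z :: "nat \<Rightarrow> 'a::{real_normed_field, euclidean_space}"
  assumes "contraction p q X"
  shows "(\<Sum>i<p. (norm (\<Sum>j<q. of_real (X i j) * z j))\<^sup>2) \<le> (\<Sum>j<q. (norm (z j))\<^sup>2)"
proof -
  have norm2: "(norm y)\<^sup>2 = (\<Sum>b\<in>Basis. (y \<bullet> b)\<^sup>2)" for y :: 'a
    unfolding power2_norm_eq_inner by (subst euclidean_inner) (simp add: power2_eq_square)
  have "(\<Sum>i<p. (norm (\<Sum>j<q. of_real (X i j) * z j))\<^sup>2)
      = (\<Sum>b\<in>Basis. \<Sum>i<p. (\<Sum>j<q. X i j * (z j \<bullet> b))\<^sup>2)"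
    unfolding norm2 by (subst sum.swap) (simp add: inner_sum_left flip: scaleR_conv_of_real)
  also have "\<dots> \<le> (\<Sum>b\<in>Basis. \<Sum>j<q. (z j \<bullet> b)\<^sup>2)"
    using assms unfolding contraction_def by (intro sum_mono) auto
  also have "\<dots> = (\<Sum>j<q. (norm (z j))\<^sup>2)"
    unfolding norm2 by (rule sum.swap)
  finally show ?thesis .
qed

lemma sum_lessThan_reindex:
  fixes f :: "nat \<Rightarrow> 'b::comm_monoid_add"
  assumes "inj_on \<gamma> {..<q}" "\<gamma> ` {..<q} \<subseteq> {..<n}" "\<And>j. j \<notin> \<gamma> ` {..<q} \<Longrightarrow> f j = 0"
  shows "(\<Sum>j<n. f j) = (\<Sum>l<q. f (\<gamma> l))"
proof -
  have "(\<Sum>j<n. f j) = (\<Sum>j\<in>\<gamma> ` {..<q}. f j)"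
    using assms by (intro sum.mono_neutral_right) auto
  then show ?thesis
    using assms(1) by (simp add: sum.reindex)
qed

lemma schur_lower_le_schur_norm:
  fixes A :: "nat \<Rightarrow> nat \<Rightarrow> 'a::{real_normed_field, euclidean_space}"
  assumes A: "\<And>i j. A i j = of_bool (E i j)" and t: "0 \<le> t" and low: "schur_lower E t"
  shows "ereal t \<le> schur_norm A"
proof -
  obtain p q \<rho> \<gamma> X v where \<rho>: "inj_on \<rho> {..<p}" and \<gamma>: "inj_on \<gamma> {..<q}" and X: "contraction p q X"
    and v: "0 < (\<Sum>j<q. (v j)\<^sup>2)"
    and le: "t\<^sup>2 * (\<Sum>j<q. (v j)\<^sup>2) \<le> (\<Sum>i<p. (\<Sum>j<q. of_bool (E (\<rho> i) (\<gamma> j)) * X i j * v j)\<^sup>2)"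
    using low unfolding schur_lower_def by blast
  have "finite (\<rho> ` {..<p} \<union> \<gamma> ` {..<q})"
    by simp
  then obtain n where "\<rho> ` {..<p} \<union> \<gamma> ` {..<q} \<subseteq> {..<n}"
    by (metis finite_nat_iff_bounded)
  then have \<rho>n: "\<rho> ` {..<p} \<subseteq> {..<n}" and \<gamma>n: "\<gamma> ` {..<q} \<subseteq> {..<n}"
    by auto
  \<comment> \<open>\<open>X\<close> is placed on the chosen rows and columns and padded with
    zeros.\<close>
  define Y :: "nat \<Rightarrow> nat \<Rightarrow> 'a" where "Y i j = (if i \<in> \<rho> ` {..<p} \<and> j \<in> \<gamma> ` {..<q} then
      of_real (X (inv_into {..<p} \<rho> i) (inv_into {..<q} \<gamma> j)) else 0)" for i j
  define u :: "nat \<Rightarrow> 'a" where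
    "u j = (if j \<in> \<gamma> ` {..<q} then of_real (v (inv_into {..<q} \<gamma> j)) else 0)" for j
  have Y: "Y (\<rho> k) (\<gamma> l) = of_real (X k l)" if "k < p" "l < q" for k l
    using that \<rho> \<gamma> by (simp add: Y_def)
  have u: "u (\<gamma> l) = of_real (v l)" if "l < q" for l
    using that \<gamma> by (simp add: u_def)
  \<comment> \<open>\<open>B\<close> is left general: the constant 1 gives \<open>Y\<close> itself,
    and \<open>A\<close> gives the Schur product.\<close>
  have apply_Y: "(l2norm n (mat_apply n n (schur_prod B Y) x))\<^sup>2
      = (\<Sum>k<p. (norm (\<Sum>l<q. B (\<rho> k) (\<gamma> l) * of_real (X k l) * x (\<gamma> l)))\<^sup>2)" for B x
  proof -
    have "(l2norm n (mat_apply n n (schur_prod B Y) x))\<^sup>2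
        = (\<Sum>k<p. (norm (\<Sum>j<n. schur_prod B Y (\<rho> k) j * x j))\<^sup>2)"
      unfolding l2norm_mat_apply_power2
      by (rule sum_lessThan_reindex[OF \<rho> \<rho>n]) (simp add: Y_def schur_prod_def)
    also have "\<dots> = (\<Sum>k<p. (norm (\<Sum>l<q. schur_prod B Y (\<rho> k) (\<gamma> l) * x (\<gamma> l)))\<^sup>2)"
      by (subst sum_lessThan_reindex[OF \<gamma> \<gamma>n]) (auto simp: Y_def schur_prod_def)
    finally show ?thesis
      by (simp add: schur_prod_def Y)
  qed
  have "op_norm n n Y \<le> 1"
  proof (rule op_norm_le)
    fix x :: "nat \<Rightarrow> 'a" assume x: "l2norm n x \<le> 1"
    have "(l2norm n (mat_apply n n Y x))\<^sup>2
        = (\<Sum>k<p. (norm (\<Sum>l<q. of_real (X k l) * x (\<gamma> l)))\<^sup>2)"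
      using apply_Y[of "\<lambda>_ _. 1" x] by (simp add: schur_prod_def)
    also have "\<dots> \<le> (\<Sum>l<q. (norm (x (\<gamma> l)))\<^sup>2)"
      by (rule contraction_euclidean[OF X])
    also have "\<dots> = (\<Sum>j\<in>\<gamma> ` {..<q}. (norm (x j))\<^sup>2)"
      using \<gamma> by (simp add: sum.reindex)
    also have "\<dots> \<le> (l2norm n x)\<^sup>2"
      unfolding l2norm_power2 using \<gamma>n by (intro sum_mono2) auto
    finally show "l2norm n (mat_apply n n Y x) \<le> 1"
      using x by (meson l2norm_nonneg order_trans power2_le_imp_le)
  qed
  then have fin: "op_norm n n (schur_prod A Y) \<le> schur_norm_fin n A"
    by (rule op_norm_schur_prod_le_schur_norm_fin)
  have u2: "(l2norm n u)\<^sup>2 = (\<Sum>l<q. (v l)\<^sup>2)"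
    unfolding l2norm_power2
    by (subst sum_lessThan_reindex[OF \<gamma> \<gamma>n]) (auto simp: u_def inv_into_f_f[OF \<gamma>])
  have "(\<Sum>l<q. A (\<rho> k) (\<gamma> l) * of_real (X k l) * u (\<gamma> l))
      = of_real (\<Sum>l<q. of_bool (E (\<rho> k) (\<gamma> l)) * X k l * v l)" for k
    by (auto simp: A u of_bool_def intro!: sum.cong)
  then have "(l2norm n (mat_apply n n (schur_prod A Y) u))\<^sup>2
      = (\<Sum>k<p. (\<Sum>l<q. of_bool (E (\<rho> k) (\<gamma> l)) * X k l * v l)\<^sup>2)"
    by (simp only: apply_Y norm_of_real power2_abs)
  then have "(t * l2norm n u)\<^sup>2 \<le> (l2norm n (mat_apply n n (schur_prod A Y) u))\<^sup>2"
    using le by (simp only: power_mult_distrib u2)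
  then have "t * l2norm n u \<le> l2norm n (mat_apply n n (schur_prod A Y) u)"
    by (rule power2_le_imp_le) simp
  also have "\<dots> \<le> op_norm n n (schur_prod A Y) * l2norm n u"
    by (rule l2norm_mat_apply_le_op_norm)
  finally have "t \<le> op_norm n n (schur_prod A Y)"
  proof (rule mult_right_le_imp_le)
    have "(l2norm n u)\<^sup>2 > 0"
      using v u2 by simp
    then show "0 < l2norm n u"
      using l2norm_nonneg[of n u] by (cases "l2norm n u = 0") (auto simp del: l2norm_nonneg)
  qed
  then have "ereal t \<le> ereal (schur_norm_fin n A)"
    using fin by simp
  also have "\<dots> \<le> schur_norm A"
    unfolding schur_norm_def by (rule SUP_upper) simp
  finally show ?thesis .
qed

lemma contraction_orthonormal:
  assumes "\<And>j k. j < q \<Longrightarrow> k < q \<Longrightarrow> (\<Sum>i<p. X i j * X i k) = of_bool (j = k)"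
  shows "contraction p q X"
  unfolding contraction_def
proof
  fix v
  have "(\<Sum>i<p. (\<Sum>j<q. X i j * v j)\<^sup>2) = (\<Sum>i<p. \<Sum>j<q. \<Sum>k<q. X i j * X i k * (v j * v k))"
    by (simp add: power2_eq_square sum_product ac_simps)
  also have "\<dots> = (\<Sum>j<q. \<Sum>i<p. \<Sum>k<q. X i j * X i k * (v j * v k))"
    by (rule sum.swap)
  also have "\<dots> = (\<Sum>j<q. \<Sum>k<q. (\<Sum>i<p. X i j * X i k) * (v j * v k))"
    unfolding sum_distrib_right by (intro sum.cong refl sum.swap)
  also have "\<dots> = (\<Sum>j<q. \<Sum>k<q. of_bool (j = k) * (v j * v k))"
    using assms by (intro sum.cong) auto
  also have "\<dots> = (\<Sum>j<q. (v j)\<^sup>2)"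
    by (simp add: of_bool_def if_distrib[of "\<lambda>x. x * _"] power2_eq_square cong: if_cong)
  finally show "(\<Sum>i<p. (\<Sum>j<q. X i j * v j)\<^sup>2) \<le> (\<Sum>j<q. (v j)\<^sup>2)"
    by simp
qed

text \<open>The columns of \<^term>\<open>W\<close> are orthogonal for the weights \<^term>\<open>a\<close>. Normalising them gives
  the contraction, and the norms of the columns form the test vector.\<close>

lemma schur_lowerI:
  fixes W :: "nat \<Rightarrow> nat \<Rightarrow> real"
  assumes \<rho>: "inj_on \<rho> {..<p}" and \<gamma>: "inj_on \<gamma> {..<q}" and "0 < q"
    and a: "\<And>i. i < p \<Longrightarrow> 0 \<le> a i"
    and orth: "\<And>j k. k < q \<Longrightarrow> j < k \<Longrightarrow> (\<Sum>i<p. a i * W i j * W i k) = 0"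
    and pos: "\<And>j. j < q \<Longrightarrow> 0 < (\<Sum>i<p. a i * (W i j)\<^sup>2)"
    and val: "t\<^sup>2 * (\<Sum>j<q. \<Sum>i<p. a i * (W i j)\<^sup>2)
        \<le> (\<Sum>i<p. a i * (\<Sum>j<q. of_bool (E (\<rho> i) (\<gamma> j)) * W i j)\<^sup>2)"
  shows "schur_lower E t"
proof -
  define d where "d j = sqrt (\<Sum>i<p. a i * (W i j)\<^sup>2)" for j
  define X where "X i j = sqrt (a i) * W i j / d j" for i j
  have d: "d j > 0" if "j < q" for j
    using pos[OF that] by (simp add: d_def)
  have d2: "(d j)\<^sup>2 = (\<Sum>i<p. a i * (W i j)\<^sup>2)" if "j < q" for j
    using pos[OF that] by (simp add: d_def)
  have "contraction p q X"
  proof (rule contraction_orthonormal)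
    fix j k assume jk: "j < q" "k < q"
    have "(\<Sum>i<p. X i j * X i k) = (\<Sum>i<p. a i * W i j * W i k / (d j * d k))"
    proof (intro sum.cong refl)
      fix i assume "i \<in> {..<p}"
      then have "sqrt (a i) * sqrt (a i) = a i"
        using a by simp
      then show "X i j * X i k = a i * W i j * W i k / (d j * d k)"
        by (simp add: X_def)
    qed
    also have "\<dots> = (\<Sum>i<p. a i * W i j * W i k) / (d j * d k)"
      by (simp add: sum_divide_distrib)
    also have "\<dots> = of_bool (j = k)"
    proof (cases j k rule: linorder_cases)
      case less
      then show ?thesis using orth[of k j] jk by simp
    next
      case equal
      then show ?thesis
        using d2[OF jk(1)] pos[OF jk(1)] by (simp add: power2_eq_square mult.assoc)
    next
      case greater
      then show ?thesis using orth[of j k] jk by (simp add: ac_simps)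
    qed
    finally show "(\<Sum>i<p. X i j * X i k) = of_bool (j = k)" .
  qed
  moreover have "0 < (\<Sum>j<q. (d j)\<^sup>2)"
    using \<open>0 < q\<close> by (intro sum_pos) (auto simp: d2 pos)
  moreover have "t\<^sup>2 * (\<Sum>j<q. (d j)\<^sup>2) \<le> (\<Sum>i<p. (\<Sum>j<q. of_bool (E (\<rho> i) (\<gamma> j)) * X i j * d j)\<^sup>2)"
  proof -
    have "(\<Sum>j<q. of_bool (E (\<rho> i) (\<gamma> j)) * X i j * d j)
        = sqrt (a i) * (\<Sum>j<q. of_bool (E (\<rho> i) (\<gamma> j)) * W i j)" for i
      unfolding sum_distrib_left
    proof (intro sum.cong refl)
      fix j assume "j \<in> {..<q}"
      then have "d j \<noteq> 0"
        using d[of j] by simp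
      then show "of_bool (E (\<rho> i) (\<gamma> j)) * X i j * d j = sqrt (a i) * (of_bool (E (\<rho> i) (\<gamma> j)) * W i j)"
        by (simp add: X_def)
    qed
    then have "(\<Sum>i<p. (\<Sum>j<q. of_bool (E (\<rho> i) (\<gamma> j)) * X i j * d j)\<^sup>2)
        = (\<Sum>i<p. a i * (\<Sum>j<q. of_bool (E (\<rho> i) (\<gamma> j)) * W i j)\<^sup>2)"
      using a by (simp add: power_mult_distrib)
    then show ?thesis
      using val d2 by simp
  qed
  ultimately show ?thesis
    unfolding schur_lower_def using \<rho> \<gamma> by blast
qed

text \<open>With literal lists every sum unfolds, and a certificate becomes a numerical
  check.\<close>

lemma schur_lower_lists:
  fixes W :: "real list list"
  assumes "distinct rs" "distinct cs" "cs \<noteq> []"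
    and "\<forall>i<length rs. 0 \<le> a ! i"
    and "\<forall>k<length cs. \<forall>j<k. (\<Sum>i<length rs. a ! i * W ! i ! j * W ! i ! k) = 0"
    and "\<forall>j<length cs. 0 < (\<Sum>i<length rs. a ! i * (W ! i ! j)\<^sup>2)"
    and "t\<^sup>2 * (\<Sum>j<length cs. \<Sum>i<length rs. a ! i * (W ! i ! j)\<^sup>2)
        \<le> (\<Sum>i<length rs. a ! i * (\<Sum>j<length cs. of_bool (E (rs ! i) (cs ! j)) * W ! i ! j)\<^sup>2)"
  shows "schur_lower E t"
  using assms
  by (intro schur_lowerI[of "(!) rs" "length rs" "(!) cs" "length cs" "(!) a" "\<lambda>i j. W ! i ! j"])
    (auto simp: inj_on_def nth_eq_iff_index_eq)

subsection \<open>Lower bounds for small patterns\<close>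

abbreviation (input) \<eta>\<^sub>2 :: real where "\<eta>\<^sub>2 \<equiv> sqrt (4/3)"
abbreviation (input) \<eta>\<^sub>3 :: real where "\<eta>\<^sub>3 \<equiv> (1 + sqrt 2) / 2"
abbreviation (input) \<eta>\<^sub>4 :: real where "\<eta>\<^sub>4 \<equiv> 1/15 * sqrt (169 + 38 * sqrt 19)"
abbreviation (input) \<eta>\<^sub>5 :: real where "\<eta>\<^sub>5 \<equiv> sqrt (3/2)"
abbreviation (input) \<eta>\<^sub>6 :: real where "\<eta>\<^sub>6 \<equiv> 2/5 * sqrt (5 + 2 * sqrt 5)"

lemma \<eta>\<^sub>3_square: "\<eta>\<^sub>3\<^sup>2 = (3 + 2 * sqrt 2) / 4"
  by (simp add: power2_eq_square field_simps)

lemma \<eta>\<^sub>4_square: "\<eta>\<^sub>4\<^sup>2 = (169 + 38 * sqrt 19) / 225"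
  by (simp add: power_mult_distrib power_divide)

lemma \<eta>\<^sub>6_square: "\<eta>\<^sub>6\<^sup>2 = (20 + 8 * sqrt 5) / 25"
  by (simp add: power_mult_distrib power_divide)

text \<open>The rational number is just above the square, about 1.51554; integer certificates are
  compared with it.\<close>

lemma \<eta>\<^sub>6_square_le: "\<eta>\<^sub>6\<^sup>2 \<le> 15156 / 10000"
proof -
  have "sqrt 5 \<le> 22361 / 10000"
    by (rule real_le_lsqrt) (simp_all add: power2_eq_square)
  then show ?thesis
    unfolding \<eta>\<^sub>6_square by simp
qed

lemmas matrix_simps = All_less_Suc eval_nat_numeral lessThan_Suc

text \<open>For the patterns of norm greater than \<open>\<eta>\<^sub>6\<close> there is room to replace the optimal contraction,
  the polar factor of an optimal rescaling of the pattern, by a nearby rational one.\<close>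

lemma schur_lower_integer_lists:
  fixes W :: "real list list"
  assumes "distinct rs" "distinct cs" "cs \<noteq> []"
    and "\<forall>k<length cs. \<forall>j<k. (\<Sum>i<length rs. W ! i ! j * W ! i ! k) = 0"
    and "\<forall>j<length cs. 0 < (\<Sum>i<length rs. (W ! i ! j)\<^sup>2)"
    and "15156 / 10000 * (\<Sum>j<length cs. \<Sum>i<length rs. (W ! i ! j)\<^sup>2)
        \<le> (\<Sum>i<length rs. (\<Sum>j<length cs. of_bool (E (rs ! i) (cs ! j)) * W ! i ! j)\<^sup>2)"
  shows "schur_lower E \<eta>\<^sub>6"
proof (rule schur_lower_lists[where a = "replicate (length rs) 1" and W = W, OF assms(1-3)])
  have "\<eta>\<^sub>6\<^sup>2 * (\<Sum>j<length cs. \<Sum>i<length rs. (W ! i ! j)\<^sup>2)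
      \<le> 15156 / 10000 * (\<Sum>j<length cs. \<Sum>i<length rs. (W ! i ! j)\<^sup>2)"
    by (intro mult_right_mono \<eta>\<^sub>6_square_le sum_nonneg) simp
  also note assms(6)
  finally show "\<eta>\<^sub>6\<^sup>2 * (\<Sum>j<length cs. \<Sum>i<length rs. replicate (length rs) 1 ! i * (W ! i ! j)\<^sup>2)
      \<le> (\<Sum>i<length rs. replicate (length rs) 1 ! i *
          (\<Sum>j<length cs. of_bool (E (rs ! i) (cs ! j)) * W ! i ! j)\<^sup>2)"
    by simp
qed (use assms in simp_all)

lemma schur_lower_staircase:
  assumes "E r1 c1" "E r1 c2" "E r1 c3"
    "\<not> E r2 c1" "E r2 c2" "E r2 c3"
    "\<not> E r3 c1" "\<not> E r3 c2" "E r3 c3"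
  shows "schur_lower E \<eta>\<^sub>6"
proof -
  have "distinct [r1, r2, r3]" "distinct [c1, c2, c3]"
    using assms by auto
  then show ?thesis
    by (rule schur_lower_integer_lists[where W = "[[12, 4, 9], [-6, 12, 6], [-4, -6, 18]]"])
      (simp_all add: matrix_simps assms)
qed

lemma schur_lower_domino:
  assumes "E r1 c1" "E r1 c2" "E r1 c3"
    "E r2 c1" "\<not> E r2 c2" "E r2 c3"
    "E r3 c1" "E r3 c2" "\<not> E r3 c3"
  shows "schur_lower E \<eta>\<^sub>6"
proof -
  have "distinct [r1, r2, r3]" "distinct [c1, c2, c3]"
    using assms by auto
  then show ?thesis
    by (rule schur_lower_integer_lists[where W = "[[1, 2, 2], [2, -2, 1], [2, 1, -2]]"])
      (simp_all add: matrix_simps assms)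
qed

lemma schur_lower_C6:
  assumes "\<not> E r1 c1" "E r1 c2" "E r1 c3"
    "E r2 c1" "\<not> E r2 c2" "E r2 c3"
    "E r3 c1" "E r3 c2" "\<not> E r3 c3"
  shows "schur_lower E \<eta>\<^sub>6"
proof -
  have "distinct [r1, r2, r3]" "distinct [c1, c2, c3]"
    using assms by auto
  \<comment> \<open>\<open>W\<close> is three times a symmetric orthogonal matrix, and each masked
    row sum is 4, so the squared ratio is 48/27.\<close>
  then show ?thesis
    by (rule schur_lower_integer_lists[where W = "[[-1, 2, 2], [2, -1, 2], [2, 2, -1]]"])
      (simp_all add: matrix_simps assms)
qed

lemma schur_lower_spider_2221:
  assumes "E r1 c1" "\<not> E r1 c2" "\<not> E r1 c3" "\<not> E r1 c4"
    "\<not> E r2 c1" "E r2 c2" "\<not> E r2 c3" "\<not> E r2 c4"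
    "\<not> E r3 c1" "\<not> E r3 c2" "E r3 c3" "\<not> E r3 c4"
    "E r4 c1" "E r4 c2" "E r4 c3" "E r4 c4"
  shows "schur_lower E \<eta>\<^sub>6"
proof -
  have "distinct [r1, r2, r3, r4]" "distinct [c1, c2, c3, c4]"
    using assms by auto
  then show ?thesis
    by (rule schur_lower_integer_lists[where W = "[[4, -1, 0, -2], [0, 4, -1, -2], [-1, 0, 4, -2], [2, 2, 2, 3]]"])
      (simp_all add: matrix_simps assms)
qed

lemma schur_lower_spider_124:
  assumes "\<not> E r1 c1" "\<not> E r1 c2" "\<not> E r1 c3" "E r1 c4"
    "\<not> E r2 c1" "\<not> E r2 c2" "E r2 c3" "\<not> E r2 c4"
    "\<not> E r3 c1" "E r3 c2" "\<not> E r3 c3" "E r3 c4"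
    "E r4 c1" "E r4 c2" "E r4 c3" "\<not> E r4 c4"
  shows "schur_lower E \<eta>\<^sub>6"
proof -
  have "distinct [r1, r2, r3, r4]" "distinct [c1, c2, c3, c4]"
    using assms by auto
  then show ?thesis
    by (rule schur_lower_integer_lists[where W = "[[8, -12, 4, 18], [-6, -6, 22, 4], [-4, 27, -4, 16], [7, 24, 12, -8]]"])
      (simp_all add: matrix_simps assms)
qed

lemma schur_lower_double_spider:
  assumes "\<not> E r1 c1" "\<not> E r1 c2" "\<not> E r1 c3" "E r1 c4"
    "\<not> E r2 c1" "\<not> E r2 c2" "E r2 c3" "\<not> E r2 c4"
    "\<not> E r3 c1" "E r3 c2" "\<not> E r3 c3" "E r3 c4"
    "E r4 c1" "\<not> E r4 c2" "E r4 c3" "E r4 c4"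
  shows "schur_lower E \<eta>\<^sub>6"
proof -
  have "distinct [r1, r2, r3, r4]" "distinct [c1, c2, c3, c4]"
    using assms by auto
  then show ?thesis
    by (rule schur_lower_integer_lists[where W = "[[-3, -3, -1, 8], [-3, 0, 5, -2], [-1, 5, 0, 6], [4, -1, 3, 6]]"])
      (simp_all add: matrix_simps assms)
qed

lemma schur_lower_spider_223:
  assumes "\<not> E r1 c1" "\<not> E r1 c2" "\<not> E r1 c3" "E r1 c4"
    "\<not> E r2 c1" "\<not> E r2 c2" "E r2 c3" "\<not> E r2 c4"
    "\<not> E r3 c1" "E r3 c2" "E r3 c3" "E r3 c4"
    "E r4 c1" "E r4 c2" "\<not> E r4 c3" "\<not> E r4 c4"
  shows "schur_lower E \<eta>\<^sub>6"
proof -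
  have "distinct [r1, r2, r3, r4]" "distinct [c1, c2, c3, c4]"
    using assms by auto
  then show ?thesis
    by (rule schur_lower_integer_lists[where W = "[[4, -4, -4, 10], [4, -4, 10, -4], [-1, 8, 8, 8], [4, 10, -4, -4]]"])
      (simp_all add: matrix_simps assms)
qed

section \<open>Certificates that attain the exact norm of a pattern\<close>

lemma schur_lower_edge:
  assumes "E r1 c1"
  shows "schur_lower E 1"
proof -
  have "distinct [r1]" "distinct [c1]"
    using assms by auto
  then show ?thesis
    by (rule schur_lower_lists[where a = "[1]" and W = "[[1]]"])
      (simp_all add: matrix_simps assms)
qed

lemma schur_lower_P4:
  assumes "E r1 c1" "E r1 c2"
    "\<not> E r2 c1" "E r2 c2"
  shows "schur_lower E (\<eta>\<^sub>2)"
proof -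
  have "distinct [r1, r2]" "distinct [c1, c2]"
    using assms by auto
  \<comment> \<open>Equality holds: the masked sums give 8 + 4 = 12, the weighted columns 3 + 6 =
    9.\<close>
  then show ?thesis
    by (rule schur_lower_lists[where a = "[2, 1]" and W = "[[1, 1], [-1, 2]]"])
      (simp_all add: matrix_simps assms)
qed

lemma schur_lower_P6:
  assumes "E r1 c1" "E r1 c2" "\<not> E r1 c3"
    "\<not> E r2 c1" "E r2 c2" "E r2 c3"
    "\<not> E r3 c1" "\<not> E r3 c2" "E r3 c3"
  shows "schur_lower E (\<eta>\<^sub>3)"
proof -
  define s where "s = sqrt (2::real)"
  have s: "s * s = 2" "1 < s" "s < 2"
    by (auto simp: s_def real_less_rsqrt real_less_lsqrt)
  then have ss: "s * (s * x) = 2 * x" for x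
    by (metis mult.assoc)
  have t: "\<eta>\<^sub>3\<^sup>2 = (3 + 2 * s) / 4"
    unfolding s_def by (rule \<eta>\<^sub>3_square)
  have "distinct [r1, r2, r3]" "distinct [c1, c2, c3]"
    using assms by auto
  then show ?thesis
    by (rule schur_lower_lists[where a = "[s, 1, 2 + s]" and W = "[[2 + s, 2 + 2 * s, - s], [- 2, 4 + 2 * s, 2 + 2 * s], [s, - 2, 2 + s]]"])
      (use s in \<open>simp_all only: t, simp_all add: matrix_simps assms algebra_simps add_divide_distrib ss\<close>)
qed

lemma schur_lower_spider_122:
  assumes "\<not> E r1 c1" "\<not> E r1 c2" "E r1 c3"
    "\<not> E r2 c1" "E r2 c2" "\<not> E r2 c3"
    "E r3 c1" "E r3 c2" "E r3 c3"
  shows "schur_lower E (\<eta>\<^sub>4)"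
proof -
  define s where "s = sqrt (19::real)"
  have s: "s * s = 19" "4 < s" "s < 5"
    by (auto simp: s_def real_less_rsqrt real_less_lsqrt)
  then have ss: "s * (s * x) = 19 * x" for x
    by (metis mult.assoc)
  have t: "\<eta>\<^sub>4\<^sup>2 = (169 + 38 * s) / 225"
    unfolding s_def by (rule \<eta>\<^sub>4_square)
  have "distinct [r1, r2, r3]" "distinct [c1, c2, c3]"
    using assms by auto
  then show ?thesis
    by (rule schur_lower_lists[where a = "[16 + 2 * s, 16 + 2 * s, 2 * (14 - 2 * s)]" and W = "[[2 * (2 * s - 14), 2 * s - 14, 2 * s + 16], [2 * (2 * s - 14), 2 * s + 16, 2 * s - 14], [2 + 4 * s, 16 + 2 * s, 16 + 2 * s]]"])
      (use s in \<open>simp_all only: t, simp_all add: matrix_simps assms algebra_simps add_divide_distrib ss\<close>)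
qed

lemma schur_lower_spider_222:
  assumes "E r1 c1" "\<not> E r1 c2" "\<not> E r1 c3"
    "\<not> E r2 c1" "E r2 c2" "\<not> E r2 c3"
    "\<not> E r3 c1" "\<not> E r3 c2" "E r3 c3"
    "E r4 c1" "E r4 c2" "E r4 c3"
  shows "schur_lower E (\<eta>\<^sub>5)"
proof -
  have "distinct [r1, r2, r3, r4]" "distinct [c1, c2, c3]"
    using assms by auto
  \<comment> \<open>The weight 5 of the centre row makes the columns orthogonal: -3 - 3 + 1 + 5 = 0.
    The squared ratio is 72/48.\<close>
  then show ?thesis
    by (rule schur_lower_lists[where a = "[1, 1, 1, 5]" and W = "[[3, -1, -1], [-1, 3, -1], [-1, -1, 3], [1, 1, 1]]"])
      (simp_all add: matrix_simps assms)
qed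

text \<open>The norm of this path is \<open>\<eta>\<^sub>6\<close> itself, which leaves no room for
  a rational contraction.\<close>

lemma schur_lower_P8:
  assumes "E r1 c1" "E r1 c2" "\<not> E r1 c3" "\<not> E r1 c4"
    "\<not> E r2 c1" "E r2 c2" "E r2 c3" "\<not> E r2 c4"
    "\<not> E r3 c1" "\<not> E r3 c2" "E r3 c3" "E r3 c4"
    "\<not> E r4 c1" "\<not> E r4 c2" "\<not> E r4 c3" "E r4 c4"
  shows "schur_lower E (\<eta>\<^sub>6)"
proof -
  define s where "s = sqrt (5::real)"
  have s: "s * s = 5" "2 < s" "s < 3"
    by (auto simp: s_def real_less_rsqrt real_less_lsqrt)
  then have ss: "s * (s * x) = 5 * x" for x
    by (metis mult.assoc)
  have t: "\<eta>\<^sub>6\<^sup>2 = (20 + 8 * s) / 25"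
    unfolding s_def by (rule \<eta>\<^sub>6_square)
  have "distinct [r1, r2, r3, r4]" "distinct [c1, c2, c3, c4]"
    using assms by auto
  then show ?thesis
    by (rule schur_lower_lists[where a = "[8, 16, s - 1, 3 + s]" and W = "[[5 + s, 5 + 3 * s, - 2 * s, s], [- s, 5 + 2 * s, 5 + 2 * s, - s], [5 + s, - 10 - 2 * s, 20 + 8 * s, 10 + 6 * s], [2 * s - 10, 5 + s, - 4 * s, 10 + 2 * s]]"])
      (use s in \<open>simp_all only: t, simp_all add: matrix_simps assms algebra_simps add_divide_distrib ss\<close>)
qed

subsection \<open>Upper bounds for graphs with few rows\<close>

lemma factorable_isolated_rows:
  assumes "0 \<le> t" "factorable E t S0 T" "\<And>r c. r \<notin> S0 \<Longrightarrow> \<not> E r c"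
  shows "factorable E t S T"
proof -
  have "factorable E t (S - S0) {}"
    unfolding factorable_def using assms(1) by (intro exI[of _ 0]) simp
  then have "factorable E t (S0 \<union> (S - S0)) (T \<union> {})"
    using assms by (intro factorable_Un) auto
  then show ?thesis
    by (rule factorable_mono) auto
qed

lemma factorable_one_row: "factorable E 1 {r} T"
  unfolding factorable_def
  by (intro exI[of _ 1] exI[of _ "\<lambda>_ _. 1"] exI[of _ "\<lambda>c _. of_bool (E r c)"]) auto

text \<open>Up to equal columns this is an induced subgraph of the path with 5 vertices, with a
  column at each end.\<close>

lemma factorable_two_rows:
  assumes "r1 \<noteq> r2"
  shows "factorable E \<eta>\<^sub>2 {r1, r2} T"
  by (rule factorable_weighted[where N = 3 and w = "\<lambda>_. 1/2" and \<alpha> = 1 and \<beta> = "4/3"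
        and x = "\<lambda>r. (!) (if r = r1 then [1, 1, 0] else [1, 0, 1])"
        and y = "\<lambda>c. (!) (if E r1 c then if E r2 c then [4/3, 2/3, 2/3] else [2/3, 4/3, -2/3]
          else if E r2 c then [2/3, -2/3, 4/3] else [0, 0, 0])"])
    (use assms in \<open>auto simp: eval_nat_numeral lessThan_Suc\<close>)

text \<open>Up to equal columns this is a path with at most 7 vertices. It arises from the 8-cycle
  by deleting vertices, and the vectors are those of the cycle without the fourth row.\<close>

lemma factorable_three_rows_path:
  assumes "distinct [r1, r2, r3]"
    and "\<And>c. \<not> (E r1 c \<and> E r3 c)" "\<And>c. E r2 c \<Longrightarrow> E r1 c \<or> E r3 c"
  shows "factorable E \<eta>\<^sub>3 {r1, r2, r3} T"
proof -
  define s where "s = sqrt (2::real)"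
  have s: "s * s = 2" "0 < s"
    by (auto simp: s_def)
  show ?thesis
    unfolding s_def[symmetric]
    by (rule factorable_weighted[where N = 3 and w = "(!) [1/2, s/2, s/2]"
          and \<alpha> = "(1 + s) / 2" and \<beta> = "(1 + s) / 2"
          and x = "\<lambda>r. (!) (if r = r1 then [1, 1, 0] else if r = r2 then [1, 0, 1] else [1, -1, 0])"
          and y = "\<lambda>c. (!) (if E r1 c then if E r2 c then [1, s/2, s/2] else [1, s/2, - s/2]
            else if E r2 c then [1, - s/2, s/2] else if E r3 c then [1, - s/2, - s/2] else [0, 0, 0])"])
      (use assms s in \<open>auto simp: eval_nat_numeral lessThan_Suc less_Suc_eq algebra_simps\<close>)
qed

text \<open>Besides a constant coordinate, the rows are the four axis directions of a plane and the
  columns the diagonals between neighbouring axes. The inner products are 1/2 plus or minus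
  1/2.\<close>

lemma factorable_four_rows_cycle:
  assumes "distinct [r1, r2, r3, r4]"
    and "\<And>c. (E r1 c, E r2 c, E r3 c, E r4 c) \<in> {(True, True, False, False),
      (False, True, True, False), (False, False, True, True), (True, False, False, True),
      (False, False, False, False)}"
  shows "factorable E \<eta>\<^sub>3 {r1, r2, r3, r4} T"
proof -
  define s where "s = sqrt (2::real)"
  have s: "s * s = 2" "0 < s"
    by (auto simp: s_def)
  show ?thesis
    unfolding s_def[symmetric]
    by (rule factorable_weighted[where N = 3 and w = "(!) [1/2, s/2, s/2]"
          and \<alpha> = "(1 + s) / 2" and \<beta> = "(1 + s) / 2"
          and x = "\<lambda>r. (!) (if r = r1 then [1, 1, 0] else if r = r2 then [1, 0, 1]
            else if r = r3 then [1, -1, 0] else [1, 0, -1])"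
          and y = "\<lambda>c. (!) (if E r1 c then if E r2 c then [1, s/2, s/2] else [1, s/2, - s/2]
            else if E r2 c then [1, - s/2, s/2] else if E r3 c then [1, - s/2, - s/2] else [0, 0, 0])"])
      (use assms s in \<open>auto simp: eval_nat_numeral lessThan_Suc less_Suc_eq algebra_simps\<close>)
qed

text \<open>Up to equal columns, an induced subgraph of the spider 133 with centre
  \<open>r0\<close>. Exchanging the two long legs changes the sign of the third coordinate.\<close>

lemma factorable_three_rows_spider_133:
  assumes "distinct [r0, r1, r2]" and "\<And>c. \<not> (E r1 c \<and> E r2 c)"
  shows "factorable E \<eta>\<^sub>4 {r0, r1, r2} T"
proof -
  define s where "s = sqrt (19::real)"
  have s: "s * s = 19" "4 < s" "s < 5"
    by (auto simp: s_def real_less_rsqrt real_less_lsqrt)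
  then have ss: "s * (s * x) = 19 * x" for x
    by (metis mult.assoc)
  \<comment> \<open>With row bound 1 and column bound \<open>\<eta>\<^sub>4\<^sup>2\<close>, all
    data stay in the field generated by the root of 19, although \<open>\<eta>\<^sub>4\<close> is a
    nested root.\<close>
  have t: "0 < \<eta>\<^sub>4" "1 * ((169 + 38 * s) / 225) \<le> \<eta>\<^sub>4\<^sup>2"
    unfolding s_def \<eta>\<^sub>4_square by (simp_all add: add_pos_pos)
  show ?thesis
    by (rule factorable_weighted[where N = 3 and w = "(!) [1, (212 + 49 * s) / 450, (8 + s) / 30]"
          and x = "\<lambda>r. (!) (if r = r0 then [1, 0, 0] else if r = r1 then [s - 4, (49 * s - 212) / 3, (8 - s) / 3]
            else [s - 4, (49 * s - 212) / 3, - (8 - s) / 3])"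
          and y = "\<lambda>c. (!) (if E r0 c then if E r1 c then [1, 9 - 2 * s, 1]
              else if E r2 c then [1, 9 - 2 * s, - 1] else [1, 8 - 2 * s, 0]
            else if E r1 c then [0, 1, 1] else if E r2 c then [0, 1, -1] else [0, 0, 0])",
          OF _ t(1) _ t(2)])
      (use assms s in \<open>auto simp: eval_nat_numeral lessThan_Suc less_Suc_eq algebra_simps add_divide_distrib diff_divide_distrib ss\<close>)
qed

text \<open>Here the centre of the spider is a column, the one meeting all three rows.\<close>

lemma factorable_three_rows_spider_222:
  assumes "distinct [r1, r2, r3]"
    and "\<And>c. (E r1 c, E r2 c, E r3 c) \<in> {(True, True, True), (True, False, False),
      (False, True, False), (False, False, True), (False, False, False)}"
  shows "factorable E \<eta>\<^sub>5 {r1, r2, r3} T"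
  by (rule factorable_weighted[where N = 4 and w = "\<lambda>_. 1/2" and \<alpha> = 1 and \<beta> = "3/2"
        and x = "\<lambda>r. (!) (if r = r1 then [1, 1, 0, 0] else if r = r2 then [1, 0, 1, 0] else [1, 0, 0, 1])"
        and y = "\<lambda>c. (!) (if E r1 c then if E r2 c then [3/2, 1/2, 1/2, 1/2] else [1/2, 3/2, -1/2, -1/2]
          else if E r2 c then [1/2, -1/2, 3/2, -1/2] else if E r3 c then [1/2, -1/2, -1/2, 3/2]
          else [0, 0, 0, 0])"])
    (use assms in \<open>auto simp: eval_nat_numeral lessThan_Suc\<close>)

text \<open>The row vectors are unit lower triangular, so with the weights as diagonal they are an
  LDL^T factorisation of their Gram matrix. The inner products then determine the column
  vectors.\<close>

lemma factorable_four_rows_P8: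
  assumes "distinct [r1, r2, r3, r4]"
    and "\<And>c. (E r1 c, E r2 c, E r3 c, E r4 c) \<in> {(True, False, False, False), (True, True, False, False),
      (False, True, True, False), (False, False, True, True), (False, False, False, False)}"
  shows "factorable E \<eta>\<^sub>6 {r1, r2, r3, r4} T"
proof -
  define s where "s = sqrt (5::real)"
  \<comment> \<open>The last weight \<open>(25 - 10 * s) / 4\<close> has to be nonnegative.\<close>
  have "s < 5/2"
    unfolding s_def by (rule real_less_lsqrt) (simp_all add: power2_eq_square)
  then have s: "s * s = 5" "2 < s" "s < 5/2"
    by (auto simp: s_def real_less_rsqrt)
  then have ss: "s * (s * x) = 5 * x" for x
    by (metis mult.assoc)
  have t: "0 < \<eta>\<^sub>6" "1 * ((20 + 8 * s) / 25) \<le> \<eta>\<^sub>6\<^sup>2"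
    unfolding s_def \<eta>\<^sub>6_square by (simp_all add: add_pos_pos)
  show ?thesis
    by (rule factorable_weighted[where N = 4
          and w = "(!) [1, (3 * s - 5) / 2, (5 * s - 5) / 8, (25 - 10 * s) / 4]"
          and x = "\<lambda>r. (!) (if r = r1 then [1, 0, 0, 0] else if r = r2 then [(3 - s) / 2, 1, 0, 0]
            else if r = r3 then [(2 - s) / 2, 1/2, 1, 0] else [(s - 2) / 2, (s - 3) / 4, (s - 1) / 2, 1])"
          and y = "\<lambda>c. (!) (if E r1 c then if E r2 c then [1, (5 + s) / 10, (1 - s) / 5, 2 * s / 25]
              else [1, - s / 5, 2/5, - (10 + 2 * s) / 25]
            else if E r2 c then [0, (5 + 3 * s) / 10, (1 + s) / 5, - 2 * s / 25]
            else if E r3 c then [0, 0, (2 + 2 * s) / 5, (10 + 2 * s) / 25] else [0, 0, 0, 0])",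
          OF _ t(1) _ t(2)])
      (use assms s in \<open>auto simp: eval_nat_numeral lessThan_Suc less_Suc_eq algebra_simps add_divide_distrib diff_divide_distrib ss\<close>)
qed

subsection \<open>Twin-free graphs without a subpattern of norm at least \<open>\<eta>\<^sub>6\<close>\<close>

text \<open>The equivalence along edges makes \<open>(S, T)\<close> a union of connected components,
  among them that of \<open>r\<close>. Hence the predicate spreads along edges.\<close>

definition covered :: "('r \<Rightarrow> 'c \<Rightarrow> bool) \<Rightarrow> 'r \<Rightarrow> real \<Rightarrow> bool" where
  "covered E r t \<longleftrightarrow> (\<exists>S T. r \<in> S \<and> (\<forall>r c. E r c \<longrightarrow> (r \<in> S \<longleftrightarrow> c \<in> T)) \<and> factorable E t S T)"

lemma covered_step: "covered E r t \<Longrightarrow> E r c \<Longrightarrow> E s c \<Longrightarrow> covered E s t"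
  unfolding covered_def by metis

lemma covered_transp:
  assumes "covered (\<lambda>c r. E r c) c t" "E r c"
  shows "covered E r t"
proof -
  obtain T S where "c \<in> T" "\<forall>c r. E r c \<longrightarrow> (c \<in> T \<longleftrightarrow> r \<in> S)" "factorable (\<lambda>c r. E r c) t T S"
    using assms(1) unfolding covered_def by blast
  then show ?thesis
    using assms(2) factorable_transp[of E t T S] unfolding covered_def by blast
qed

lemma coveredI:
  assumes "r \<in> R" "\<And>r c s. r \<in> R \<Longrightarrow> E r c \<Longrightarrow> E s c \<Longrightarrow> s \<in> R" "\<And>T. factorable E t R T"
  shows "covered E r t"
  unfolding covered_def
  using assms by (intro exI[of _ R] exI[of _ "{c. \<exists>r\<in>R. E r c}"]) blast

text \<open>The premises \<open>E r c\<close> exempt isolated vertices: when twins are collapsed,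
  the discarded ones stay in the type without edges.\<close>

locale small_graph =
  fixes E :: "'r \<Rightarrow> 'c \<Rightarrow> bool"
  assumes twin_row: "E r c \<Longrightarrow> (\<And>d. E r d \<longleftrightarrow> E s d) \<Longrightarrow> r = s"
    and twin_col: "E r c \<Longrightarrow> (\<And>s. E s c \<longleftrightarrow> E s d) \<Longrightarrow> c = d"
    and small: "\<not> schur_lower E \<eta>\<^sub>6"
begin

section \<open>Forbidden induced subgraphs\<close>

lemma small_graph_transp: "small_graph (\<lambda>c r. E r c)"
proof
  have "0 < \<eta>\<^sub>6"
    by (simp add: add_pos_pos)
  then show "\<not> schur_lower (\<lambda>c r. E r c) \<eta>\<^sub>6"
    using small schur_lower_transp[of E \<eta>\<^sub>6] by blast
qed (metis twin_row twin_col)+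

text \<open>As there are no twins, some column \<open>f\<close> meets exactly one of the two rows
  and some row \<open>w\<close> exactly one of the two columns. Together with the 4-cycle they span
  two 4-cycles sharing an edge if \<open>w\<close> meets \<open>f\<close>, and a staircase
  otherwise.\<close>

lemma C4_free:
  assumes e: "E r c" "E r d" "E s c" "E s d" and neq: "r \<noteq> s" "c \<noteq> d"
  shows False
proof -
  have 1: False if "E x a" "E x b" "E y a" "E y b" "E x f" "\<not> E y f" "E w a" "\<not> E w b" for x y a b w f
  proof (cases "E w f")
    case True
    then show False
      using small schur_lower_domino[of E x a b f w y] that by blast
  next
    case False
    then show False
      using small schur_lower_staircase[of E x f b a y w] that by blast
  qed
  obtain f where f: "E r f \<noteq> E s f"
    using twin_row[OF e(1), of s] neq(1) by blast
  obtain w where w: "E w c \<noteq> E w d"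
    using twin_col[OF e(1), of d] neq(2) by blast
  show False
    using 1[of r c d s f w] 1[of r d c s f w] 1[of s c d r f w] 1[of s d c r f w] e f w by blast
qed

text \<open>A chord would create a 4-cycle, so the 6-cycle is induced.\<close>

lemma C6_free:
  assumes "E r a" "E r b" "E s b" "E s c" "E u c" "E u a"
    and "r \<noteq> s" "s \<noteq> u" "r \<noteq> u" "a \<noteq> b" "b \<noteq> c" "a \<noteq> c"
  shows False
proof -
  have "\<not> E r c" "\<not> E s a" "\<not> E u b"
    using assms C4_free by blast+
  then show False
    using small schur_lower_C6[of E r c a b s u] schur_lower_C6[of E r c b a u s] assms by blast
qed

text \<open>The given edges form the spider, and any further edge would close a 4-cycle through
  \<open>r\<close>.\<close>

lemma spider_2221_free:
  assumes "E r a" "E r b" "E r c" "E r d" "distinct [a, b, c, d]"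
    and "E s a" "E u b" "E v c" "s \<noteq> r" "u \<noteq> r" "v \<noteq> r"
  shows False
proof -
  have "\<not> E x y" if "x \<noteq> r" "E x z" "E r z" "E r y" "y \<noteq> z" for x y z
    using C4_free that by blast
  then have "schur_lower E \<eta>\<^sub>6"
    using assms by (intro schur_lower_spider_2221[of E s a b c d u v r]) auto
  then show False
    using small by blast
qed

text \<open>The long leg is \<open>a\<close>, \<open>s\<close>, \<open>d\<close>. An edge from
  \<open>r\<close> to \<open>d\<close> would close a 4-cycle, one from \<open>u\<close> or
  \<open>v\<close> to \<open>d\<close> a 6-cycle.\<close>

lemma spider_223_free:
  assumes "E r a" "E r b" "E r c" "distinct [a, b, c]"
    and "E s a" "E u b" "E v c" "s \<noteq> r" "u \<noteq> r" "v \<noteq> r" and "E s d" "d \<noteq> a"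
  shows False
proof -
  have *: "\<not> E x y" if "x \<noteq> r" "E x z" "E r z" "E r y" "y \<noteq> z" for x y z
    using C4_free that by blast
  have "s \<noteq> u" "s \<noteq> v"
    using *[of u b a] *[of v c a] assms by auto
  have "\<not> E r d"
    using C4_free assms by metis
  then have "d \<noteq> b" "d \<noteq> c"
    using assms by auto
  have "\<not> E u d"
    using C6_free[of u b d s a r] C6_free[of u d b r a s] assms \<open>s \<noteq> u\<close> \<open>d \<noteq> b\<close> by auto
  moreover have "\<not> E v d"
    using C6_free[of v d c r a s] assms \<open>s \<noteq> v\<close> \<open>d \<noteq> c\<close> by auto
  ultimately have "schur_lower E \<eta>\<^sub>6"
    using assms * \<open>\<not> E r d\<close> by (intro schur_lower_spider_223[of E v d a b c u r s]) auto
  then show False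
    using small by blast
qed

text \<open>The legs at \<open>r\<close> are \<open>a\<close>; \<open>c\<close>, \<open>u\<close>;
  and \<open>b\<close>, \<open>s\<close>, \<open>d\<close>, \<open>w\<close>. Any further edge among
  these vertices would close a 4-cycle or a 6-cycle.\<close>

lemma spider_124_free:
  assumes "E r a" "E r b" "E r c" "distinct [a, b, c]"
    and "E u c" "u \<noteq> r" "E s b" "s \<noteq> r" "E s d" "d \<noteq> b" "E w d" "w \<noteq> s"
  shows False
proof -
  have *: "\<not> E x y" if "x \<noteq> r" "E x z" "E r z" "E r y" "y \<noteq> z" for x y z
    using C4_free that by blast
  have "\<not> E r d"
    using C4_free assms by metis
  then have "d \<noteq> a" "d \<noteq> c" "w \<noteq> r"
    using assms by auto
  have "u \<noteq> s"
    using *[of s b c] assms by auto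
  have "\<not> E w b"
    using C4_free assms by metis
  have "\<not> E w a"
    using C6_free[of w d a r b s] assms \<open>w \<noteq> r\<close> \<open>d \<noteq> a\<close> by auto
  moreover have "\<not> E w c"
    using C6_free[of w d c r b s] assms \<open>w \<noteq> r\<close> \<open>d \<noteq> c\<close> by auto
  moreover have "\<not> E u d"
    using C6_free[of u d c r b s] assms \<open>u \<noteq> s\<close> \<open>d \<noteq> c\<close> by auto
  ultimately have "schur_lower E \<eta>\<^sub>6"
    using assms * \<open>\<not> E r d\<close> \<open>\<not> E w b\<close> by (intro schur_lower_spider_124[of E w a b c d u s r]) auto
  then show False
    using small by blast
qed

text \<open>The branching vertices are \<open>r\<close>, with legs \<open>a\<close> and
  \<open>b\<close>, \<open>u\<close>, and \<open>c\<close>, with legs \<open>v\<close> and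
  \<open>s\<close>, \<open>d\<close>.\<close>

lemma double_spider_free:
  assumes "E r a" "E r b" "E r c" "distinct [a, b, c]"
    and "E u b" "u \<noteq> r" "E s c" "E v c" "distinct [r, s, v]" "E s d" "d \<noteq> c"
  shows False
proof -
  have *: "\<not> E x y" if "x \<noteq> r" "E x z" "E r z" "E r y" "y \<noteq> z" for x y z
    using C4_free that by blast
  have "\<not> E r d" "\<not> E v d"
    using C4_free[of r c d s] C4_free[of v c d s] assms by auto
  have "u \<noteq> s"
    using *[of s c b] assms by auto
  have "d \<noteq> a" "d \<noteq> b"
    using assms \<open>\<not> E r d\<close> by auto
  have "\<not> E u d"
    using C6_free[of u d b r c s] assms \<open>u \<noteq> s\<close> \<open>d \<noteq> b\<close> by auto
  moreover have "\<not> E v a" "\<not> E v b" "\<not> E u a" "\<not> E u c" "\<not> E s a" "\<not> E s b"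
    using *[of v c a] *[of v c b] *[of u b a] *[of u b c] *[of s c a] *[of s c b] assms by auto
  ultimately have "schur_lower E \<eta>\<^sub>6"
    using assms \<open>\<not> E r d\<close> \<open>\<not> E v d\<close> by (intro schur_lower_double_spider[of E v a d b c u s r])
  then show False
    using small by blast
qed

section \<open>Components with a vertex of degree 3\<close>

lemma leaf_unique:
  assumes "E r a" "E r b" "a \<noteq> b"
  shows "(\<exists>s. s \<noteq> r \<and> E s a) \<or> (\<exists>s. s \<noteq> r \<and> E s b)"
  using twin_col[of r a b] assms by metis

text \<open>Two leaves at \<open>r\<close> would be twins, so three of the four neighbours extend
  and the spider 2221 appears.\<close>

lemma degree_le_3:
  assumes "E r a" "E r b" "E r c" "E r d" "distinct [a, b, c, d]"
  shows False
proof -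
  define N where "N c \<longleftrightarrow> (\<exists>s. s \<noteq> r \<and> E s c)" for c
  have leaf: "N x \<or> N y" if "E r x" "E r y" "x \<noteq> y" for x y
    using leaf_unique that unfolding N_def by blast
  have *: False if "N a" "N b" "N c" "E r a" "E r b" "E r c" "E r d" "distinct [a, b, c, d]" for a b c d
    using spider_2221_free[of r a b c d] that unfolding N_def by blast
  show False
    using *[of a b c d] *[of b c d a] *[of a c d b] *[of a b d c] assms
      leaf[of a b] leaf[of a c] leaf[of a d] leaf[of b c] leaf[of b d] leaf[of c d] by auto
qed

text \<open>Since \<open>s\<close> and \<open>v\<close> are not twins, a column would meet exactly
  one of them, making \<open>r\<close> and \<open>c\<close> the branching vertices of the forbidden
  tree.\<close>

lemma column_degree_le_2:
  assumes "E r a" "E r b" "E r c" "distinct [a, b, c]" "E u b" "u \<noteq> r"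
    and "E s c" "E v c" "s \<noteq> r" "v \<noteq> r"
  shows "s = v"
proof (rule ccontr)
  assume "s \<noteq> v"
  then obtain d where "E s d \<noteq> E v d"
    using twin_row[OF assms(7), of v] by blast
  then show False
    using double_spider_free[of r a b c u s v d] double_spider_free[of r a b c u v s d] assms \<open>s \<noteq> v\<close>
    by auto
qed

text \<open>Absence of the spider 223 stops every leg at length 2, so the component is the spider
  222.\<close>

lemma degree_3_all_extended:
  assumes "E r a" "E r b" "E r c" "distinct [a, b, c]"
    and "E s a" "E u b" "E v c" "s \<noteq> r" "u \<noteq> r" "v \<noteq> r"
  shows "covered E r \<eta>\<^sub>5 \<and> schur_lower E \<eta>\<^sub>5"
proof
  have only: "d = z" if "z \<in> {a, b, c}" "E x z" "E x d" "x \<noteq> r" for x z d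
    using that spider_223_free[of r a b c x u v d] spider_223_free[of r b a c x s v d]
      spider_223_free[of r c a b x s u d] assms by auto
  have r: "d \<in> {a, b, c}" if "E r d" for d
    using degree_le_3[of r a b c d] assms that by auto
  \<comment> \<open>The graph is transposed because the upper bound for the spider 222 wants its
    centre among the columns.\<close>
  have "covered (\<lambda>c r. E r c) a \<eta>\<^sub>5"
  proof (rule coveredI)
    show "a \<in> {a, b, c}"
      by simp
    show "d \<in> {a, b, c}" if "z \<in> {a, b, c}" "E x z" "E x d" for x z d
      using that r only by (cases "x = r") blast+
    show "factorable (\<lambda>c r. E r c) \<eta>\<^sub>5 {a, b, c} T" for T
    proof (rule factorable_three_rows_spider_222)
      show "(E x a, E x b, E x c) \<in> {(True, True, True), (True, False, False),
        (False, True, False), (False, False, True), (False, False, False)}" for x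
        using only[of a x b] only[of a x c] only[of b x c] assms by (cases "x = r") auto
    qed fact
  qed
  then show "covered E r \<eta>\<^sub>5"
    using assms(1) by (rule covered_transp)
  have "\<not> E s b" "\<not> E s c" "\<not> E u a" "\<not> E u c" "\<not> E v a" "\<not> E v b"
    using only assms by fastforce+
  then show "schur_lower E \<eta>\<^sub>5"
    using assms by (intro schur_lower_spider_222[of E s a b c u v r])
qed

text \<open>The legs do not branch at \<open>b\<close> or \<open>c\<close>, and absence of the
  spider 124 stops them at length 3. The component therefore lies inside the spider 133 and contains
  the spider 122.\<close>

lemma degree_3_leaf:
  assumes "E r a" "E r b" "E r c" "distinct [a, b, c]"
    and leaf: "\<And>x. E x a \<Longrightarrow> x = r" and "E s b" "E u c" "s \<noteq> r" "u \<noteq> r"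
  shows "covered E r \<eta>\<^sub>4 \<and> schur_lower E \<eta>\<^sub>4"
proof
  note g = assms(1-4,6-9)
  have *: "\<not> E x y" if "x \<noteq> r" "E x z" "E r z" "E r y" "y \<noteq> z" for x y z
    using C4_free that by blast
  have "s \<noteq> u"
    using *[of s b c] g by auto
  have r: "d \<in> {a, b, c}" if "E r d" for d
    using degree_le_3[of r a b c d] g that by auto
  have b: "x \<in> {r, s}" if "E x b" for x
    using column_degree_le_2[of r a c b u s x] that g by auto
  have c: "x \<in> {r, u}" if "E x c" for x
    using column_degree_le_2[of r a b c s u x] that g by auto
  have s: "x = s" if "E s d" "d \<noteq> b" "E x d" for x d
    using spider_124_free[of r a b c u s d x] that g by auto
  have u: "x = u" if "E u d" "d \<noteq> c" "E x d" for x d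
    using spider_124_free[of r a c b s u d x] that g by auto
  show "covered E r \<eta>\<^sub>4"
  proof (rule coveredI)
    show "r \<in> {r, s, u}"
      by simp
    show "y \<in> {r, s, u}" if "x \<in> {r, s, u}" "E x d" "E y d" for x y d
      using that leaf[of y] r[of d] b[of y] c[of y] s[of d y] u[of d y] by auto
    show "factorable E \<eta>\<^sub>4 {r, s, u} T" for T
    proof (rule factorable_three_rows_spider_133)
      show "\<not> (E s d \<and> E u d)" for d
        using b[of u] s[of d u] g \<open>s \<noteq> u\<close> by auto
    qed (use g \<open>s \<noteq> u\<close> in auto)
  qed
  have "\<not> E u a" "\<not> E u b" "\<not> E s a" "\<not> E s c"
    using *[of u c a] *[of u c b] *[of s b a] *[of s b c] g by auto
  then show "schur_lower E \<eta>\<^sub>4"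
    using g by (intro schur_lower_spider_122[of E u a b c s r])
qed

text \<open>Components of norm \<open>\<eta>\<^sub>4\<close> or \<open>\<eta>\<^sub>5\<close>. They
  include all those with a vertex of degree 3, so all degrees are at most 2 along a component that
  is not large.\<close>

definition large :: "'r \<Rightarrow> bool" where
  "large r \<longleftrightarrow> (\<exists>t\<in>{\<eta>\<^sub>4, \<eta>\<^sub>5}. covered E r t \<and> schur_lower E t)"

lemma large_step: "large r \<Longrightarrow> E r c \<Longrightarrow> E s c \<Longrightarrow> large s"
  unfolding large_def using covered_step[of E r _ c s] by blast

lemma large_degree_3:
  assumes "E r a" "E r b" "E r c" "distinct [a, b, c]"
  shows "large r"
proof -
  define N where "N c \<longleftrightarrow> (\<exists>s. s \<noteq> r \<and> E s c)" for c
  have leaf: "N x \<or> N y" if "E r x" "E r y" "x \<noteq> y" for x y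
    using leaf_unique that unfolding N_def by blast
  have *: "large r" if "N b" "N c" "E r a" "E r b" "E r c" "distinct [a, b, c]" for a b c
  proof (cases "N a")
    case True
    then show ?thesis
      using degree_3_all_extended[of r a b c] that unfolding large_def N_def by blast
  next
    case False
    then show ?thesis
      using degree_3_leaf[of r a b c] that unfolding large_def N_def by blast
  qed
  have "N a \<or> N b" "N a \<or> N c" "N b \<or> N c" "distinct [b, a, c]" "distinct [c, a, b]"
    using leaf assms by auto
  then show ?thesis
    using *[of b c a] *[of a c b] *[of a b c] assms by blast
qed

end

text \<open>The hypotheses are symmetric in rows and columns, so the result for rows applies to the
  transposed graph and is carried back.\<close>

lemma (in small_graph) large_column_degree_3:
  assumes "E r c" "E s c" "E u c" "distinct [r, s, u]"
  shows "large r"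
proof -
  interpret T: small_graph "\<lambda>c r. E r c"
    by (rule small_graph_transp)
  obtain t where t: "t \<in> {\<eta>\<^sub>4, \<eta>\<^sub>5}" "covered (\<lambda>c r. E r c) c t" "schur_lower (\<lambda>c r. E r c) t"
    using T.large_degree_3[of r c s u] assms unfolding T.large_def by blast
  have "0 < t"
    using t(1) by safe (simp_all add: add_pos_pos)
  then show ?thesis
    using t assms covered_transp[of E c t r] schur_lower_transp[of E t] unfolding large_def by blast
qed

section \<open>Components that are paths or 8-cycles\<close>

context small_graph
begin

lemma row_degree_le_2: "\<not> large r \<Longrightarrow> E r a \<Longrightarrow> E r b \<Longrightarrow> E r c \<Longrightarrow> a = b \<or> a = c \<or> b = c"
  using large_degree_3[of r a b c] by auto

lemma col_degree_le_2: "\<not> large r \<Longrightarrow> E r c \<Longrightarrow> E s c \<Longrightarrow> E u c \<Longrightarrow> r = s \<or> r = u \<or> s = u"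
  using large_column_degree_3[of r c s u] by auto

text \<open>The path \<open>g\<close>, \<open>e\<close>, \<open>c\<close>, \<open>m\<close>,
  \<open>d\<close>, \<open>u\<close>, \<open>f\<close>, \<open>v\<close> has 8 vertices and would be
  a forbidden induced path unless \<open>v\<close> meets \<open>g\<close>. So it closes to an
  8-cycle, which by the degree bounds is the whole component.\<close>

lemma cycle_covered:
  assumes P: "\<not> large m" and "E e c" "E m c" "E m d" "E u d" "E u f" "E v f" "E e g"
    and "distinct [e, m, u, v]" "g \<noteq> c"
  shows "covered E m \<eta>\<^sub>3"
proof -
  have P': "\<not> large e" "\<not> large u" "\<not> large v"
    using P assms large_step by metis+
  have cd: "c \<noteq> d" "d \<noteq> f"
    using col_degree_le_2[OF P, of c e u] col_degree_le_2[OF P, of d u v] assms by auto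
  have nd: "\<not> E e d" "\<not> E v d" "\<not> E u c" "\<not> E v c"
    using col_degree_le_2[OF P, of d e u] col_degree_le_2[OF P, of d u v]
      col_degree_le_2[OF P, of c e u] col_degree_le_2[OF P, of c e v] assms by auto
  have "c \<noteq> f" "g \<noteq> d"
    using nd assms by auto
  have nf: "\<not> E e f" "\<not> E m f" "\<not> E m g"
    using C6_free[of e f c m d u] row_degree_le_2[OF P, of c d f] row_degree_le_2[OF P, of c d g]
      assms cd \<open>c \<noteq> f\<close> \<open>g \<noteq> d\<close> by auto
  then have "g \<noteq> f"
    using assms by auto
  then have ng: "\<not> E u g"
    using row_degree_le_2[OF P'(2), of d f g] assms cd \<open>g \<noteq> d\<close> by auto
  have "E v g"
    using small schur_lower_P8[of E e g c d f m u v] assms nd nf ng by blast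
  have cols: "x \<in> {g, c}" if "E e x" for x
    using row_degree_le_2[OF P'(1), of g c x] assms that by auto
  moreover have "x \<in> {c, d}" if "E m x" for x
    using row_degree_le_2[OF P, of c d x] assms that cd by auto
  moreover have "x \<in> {d, f}" if "E u x" for x
    using row_degree_le_2[OF P'(2), of d f x] assms that cd by auto
  moreover have "x \<in> {f, g}" if "E v x" for x
    using row_degree_le_2[OF P'(3), of f g x] assms that \<open>E v g\<close> \<open>g \<noteq> f\<close> by auto
  moreover have "x \<in> {e, m}" if "E x c" for x
    using col_degree_le_2[OF P, of c e x] assms that by auto
  moreover have "x \<in> {m, u}" if "E x d" for x
    using col_degree_le_2[OF P, of d u x] assms that by auto
  moreover have "x \<in> {u, v}" if "E x f" for x
    using col_degree_le_2[OF P'(2), of f v x] assms that by auto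
  moreover have "x \<in> {e, v}" if "E x g" for x
    using col_degree_le_2[OF P'(1), of g v x] assms that \<open>E v g\<close> by auto
  note closed = calculation this
  show ?thesis
  proof (rule coveredI)
    show "m \<in> {e, m, u, v}"
      by simp
    show "y \<in> {e, m, u, v}" if "x \<in> {e, m, u, v}" "E x z" "E y z" for x y z
      using that closed(1-4)[of z] closed(5-8)[of y] by auto
    show "factorable E \<eta>\<^sub>3 {e, m, u, v} T" for T
    proof (rule factorable_four_rows_cycle)
      fix x
      consider "x = c" | "x = d" | "x = f" | "x = g" | "x \<notin> {c, d, f, g}"
        by blast
      then show "(E e x, E m x, E u x, E v x) \<in> {(True, True, False, False),
          (False, True, True, False), (False, False, True, True), (True, False, False, True),
          (False, False, False, False)}"
      proof cases
        case 5
        then have "\<not> E e x" "\<not> E m x" "\<not> E u x" "\<not> E v x"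
          using closed(1-4)[of x] by auto
        then show ?thesis by simp
      qed (use assms nd nf ng \<open>E v g\<close> in simp_all)
    qed fact
  qed
qed

text \<open>A further column at \<open>e\<close> or \<open>v\<close> leads to the 8-cycle. Otherwise
  the component is a path with 7 vertices, handled through its three columns. Both contain an
  induced path with 6 vertices, which gives the lower bound.\<close>

lemma four_rows_covered:
  assumes P: "\<not> large m" and "E e c" "E m c" "E m d" "E u d" "E u f" "E v f"
    and "distinct [e, m, u, v]"
  shows "covered E m \<eta>\<^sub>3 \<and> schur_lower E \<eta>\<^sub>3"
proof
  have P': "\<not> large u"
    using P assms large_step by metis
  have cd: "c \<noteq> d" "d \<noteq> f"
    using col_degree_le_2[OF P, of c e u] col_degree_le_2[OF P, of d u v] assms by auto
  have nd: "\<not> E e d" "\<not> E u c"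
    using col_degree_le_2[OF P, of d e u] col_degree_le_2[OF P, of c e u] assms by auto
  have "c \<noteq> f"
    using nd assms by auto
  have nf: "\<not> E e f" "\<not> E m f"
    using C6_free[of e f c m d u] row_degree_le_2[OF P, of c d f] assms cd \<open>c \<noteq> f\<close> by auto
  show "schur_lower E \<eta>\<^sub>3"
    using assms nd nf by (intro schur_lower_P6[of E u f d c m e])
  show "covered E m \<eta>\<^sub>3"
  proof (cases "(\<exists>g. E e g \<and> g \<noteq> c) \<or> (\<exists>g. E v g \<and> g \<noteq> f)")
    case True
    then consider g where "E e g" "g \<noteq> c" | g where "E v g" "g \<noteq> f"
      by blast
    then show ?thesis
    proof cases
      case 1
      then show ?thesis
        using cycle_covered[OF P, of e c d u f v g] assms by blast
    next
      case 2
      then have "covered E u \<eta>\<^sub>3"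
        using cycle_covered[OF P', of v f d m c e g] assms by auto
      then show ?thesis
        using covered_step[of E u \<eta>\<^sub>3 d m] assms by blast
    qed
  next
    case False
    then have cols: "\<And>x. E e x \<Longrightarrow> x = c" "\<And>x. E v x \<Longrightarrow> x = f"
      by blast+
    moreover have "x \<in> {c, d}" if "E m x" for x
      using row_degree_le_2[OF P, of c d x] assms that cd by auto
    moreover have "x \<in> {d, f}" if "E u x" for x
      using row_degree_le_2[OF P', of d f x] assms that cd by auto
    moreover have "x \<in> {e, m}" if "E x c" for x
      using col_degree_le_2[OF P, of c e x] assms that by auto
    moreover have "x \<in> {m, u}" if "E x d" for x
      using col_degree_le_2[OF P, of d u x] assms that by auto
    moreover have "x \<in> {u, v}" if "E x f" for x
      using col_degree_le_2[OF P', of f v x] assms that by auto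
    note closed = calculation this
    have "covered (\<lambda>c r. E r c) c \<eta>\<^sub>3"
    proof (rule coveredI)
      show "c \<in> {c, d, f}"
        by simp
      show "z \<in> {c, d, f}" if "y \<in> {c, d, f}" "E x y" "E x z" for x y z
        using that closed(1-4)[of z] closed(5-7)[of x] by auto
      show "factorable (\<lambda>c r. E r c) \<eta>\<^sub>3 {c, d, f} T" for T
      proof (rule factorable_three_rows_path)
        show "\<not> (E x c \<and> E x f)" for x
          using closed(5)[of x] nf by blast
        show "E x c \<or> E x f" if "E x d" for x
          using closed(6)[OF that] assms by blast
      qed (use cd \<open>c \<noteq> f\<close> in auto)
    qed
    then show ?thesis
      using assms(3) by (rule covered_transp)
  qed
qed

text \<open>A further row leads to \<open>four_rows_covered\<close>. Without one, a further column
  at \<open>e\<close> or \<open>u\<close> gives a path with 6 or 7 vertices; with neither, the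
  component is a path with 5 vertices, handled through its two columns.\<close>

lemma three_rows_covered:
  assumes P: "\<not> large m" and "E e c" "E m c" "E m d" "E u d" and "distinct [e, m, u]"
  shows "\<exists>t\<in>{\<eta>\<^sub>2, \<eta>\<^sub>3}. covered E m t \<and> schur_lower E t"
proof -
  have cd: "c \<noteq> d"
    using col_degree_le_2[OF P, of c e u] assms by auto
  have nd: "\<not> E e d" "\<not> E u c"
    using col_degree_le_2[OF P, of d e u] col_degree_le_2[OF P, of c e u] assms by auto
  have m: "x \<in> {c, d}" if "E m x" for x
    using row_degree_le_2[OF P, of c d x] assms that cd by auto
  have c: "x \<in> {e, m}" if "E x c" for x
    using col_degree_le_2[OF P, of c e x] assms that by auto
  have d: "x \<in> {m, u}" if "E x d" for x
    using col_degree_le_2[OF P, of d u x] assms that by auto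
  have eu: "\<not> (E e x \<and> E u x)" for x
    using C6_free[of e x c m d u] assms cd nd by auto
  show ?thesis
  proof (cases "\<forall>x\<in>{e, m, u}. \<forall>y z. E x z \<longrightarrow> E y z \<longrightarrow> y \<in> {e, m, u}")
    case False
    then obtain x y z where xyz: "x \<in> {e, m, u}" "E x z" "E y z" "y \<notin> {e, m, u}"
      by blast
    then have "x \<noteq> m"
      using m c d by blast
    then show ?thesis
      using four_rows_covered[OF P, of e c d u z y] four_rows_covered[OF P, of u d c e z y] xyz assms
      by auto
  next
    case closed: True
    show ?thesis
    proof (cases "(\<exists>f. E e f \<and> f \<noteq> c) \<or> (\<exists>f. E u f \<and> f \<noteq> d)")
      case True
      then have "schur_lower E \<eta>\<^sub>3"
      proof
        assume "\<exists>f. E e f \<and> f \<noteq> c"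
        then obtain f where "E e f" "f \<noteq> c"
          by blast
        then show ?thesis
          using assms nd eu m by (intro schur_lower_P6[of E e f c d m u]) blast+
      next
        assume "\<exists>f. E u f \<and> f \<noteq> d"
        then obtain f where "E u f" "f \<noteq> d"
          by blast
        then show ?thesis
          using assms nd eu m by (intro schur_lower_P6[of E u f d c m e]) blast+
      qed
      moreover have "covered E m \<eta>\<^sub>3"
      proof (rule coveredI)
        show "m \<in> {e, m, u}"
          by simp
        show "y \<in> {e, m, u}" if "x \<in> {e, m, u}" "E x z" "E y z" for x y z
          using closed that by blast
        show "factorable E \<eta>\<^sub>3 {e, m, u} T" for T
          using assms eu m by (intro factorable_three_rows_path) blast+
      qed
      ultimately show ?thesis
        by blast
    next
      case False
      have "covered (\<lambda>c r. E r c) c \<eta>\<^sub>2"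
      proof (rule coveredI)
        show "c \<in> {c, d}"
          by simp
        show "z \<in> {c, d}" if "y \<in> {c, d}" "E x y" "E x z" for x y z
          using that False c[of x] d[of x] m[of z] by auto
        show "factorable (\<lambda>c r. E r c) \<eta>\<^sub>2 {c, d} T" for T
          using cd by (rule factorable_two_rows)
      qed
      then have "covered E m \<eta>\<^sub>2"
        using assms(3) by (rule covered_transp)
      moreover have "schur_lower E \<eta>\<^sub>2"
        using assms nd by (intro schur_lower_P4[of E m d c e])
      ultimately show ?thesis
        by blast
    qed
  qed
qed

text \<open>The cases go by the number of rows in the component. One row gives norm 1. Two rows are
  not twins and so contain a path with 4 vertices. With more rows, \<open>r\<close> or
  \<open>s\<close> is the middle row for \<open>three_rows_covered\<close>.\<close>

lemma not_large_covered:
  assumes P: "\<not> large r" and "E r c"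
  shows "\<exists>t\<in>{1, \<eta>\<^sub>2, \<eta>\<^sub>3}. covered E r t \<and> schur_lower E t"
proof (cases "\<exists>s d. s \<noteq> r \<and> E r d \<and> E s d")
  case False
  then have "covered E r 1"
    by (intro coveredI[of r "{r}"] factorable_one_row) auto
  then show ?thesis
    using schur_lower_edge[of E, OF assms(2)] by blast
next
  case True
  then obtain s d where sd: "s \<noteq> r" "E r d" "E s d"
    by blast
  then have P': "\<not> large s"
    using P large_step by blast
  show ?thesis
  proof (cases "\<forall>x\<in>{r, s}. \<forall>y z. E x z \<longrightarrow> E y z \<longrightarrow> y \<in> {r, s}")
    case True
    have "covered E r \<eta>\<^sub>2"
    proof (rule coveredI)
      show "r \<in> {r, s}"
        by simp
      show "y \<in> {r, s}" if "x \<in> {r, s}" "E x z" "E y z" for x y z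
        using True that by blast
      show "factorable E \<eta>\<^sub>2 {r, s} T" for T
        using sd by (intro factorable_two_rows) auto
    qed
    moreover obtain f where "E r f \<noteq> E s f"
      using twin_row[of r d s] sd by blast
    then have "schur_lower E \<eta>\<^sub>2"
      using schur_lower_P4[of E r f d s] schur_lower_P4[of E s f d r] sd by blast
    ultimately show ?thesis
      by blast
  next
    case False
    then obtain x y z where xyz: "x \<in> {r, s}" "E x z" "E y z" "y \<notin> {r, s}"
      by blast
    show ?thesis
    proof (cases "x = r")
      case True
      then show ?thesis
        using three_rows_covered[OF P, of s d z y] xyz sd by auto
    next
      case False
      then have "\<exists>t\<in>{\<eta>\<^sub>2, \<eta>\<^sub>3}. covered E s t \<and> schur_lower E t"
        using three_rows_covered[OF P', of r d z y] xyz sd by auto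
      then show ?thesis
        using covered_step[of E s _ d r] sd by blast
    qed
  qed
qed

theorem row_covered:
  assumes "E r c"
  shows "\<exists>t\<in>{1, \<eta>\<^sub>2, \<eta>\<^sub>3, \<eta>\<^sub>4, \<eta>\<^sub>5}. covered E r t \<and> schur_lower E t"
  using not_large_covered[OF _ assms] unfolding large_def by blast

end

subsection \<open>Gluing components and collapsing twins\<close>

text \<open>Closed pieces are split off one after another, each removing at least one row from the
  finite set \<open>S\<close>.\<close>

lemma factorable_finite:
  assumes cov: "\<And>r c. E r c \<Longrightarrow> covered E r t" and t: "0 \<le> t" and "finite S"
  shows "factorable E t S T"
  using \<open>finite S\<close>
proof (induction S arbitrary: T rule: finite_psubset_induct)
  case (psubset S)
  show ?case
  proof (cases "S = {}")
    case True
    then show ?thesis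
      using t by (simp add: factorable_empty)
  next
    case False
    then obtain r where r: "r \<in> S"
      by blast
    have "covered E r t"
    proof (cases "\<exists>c. E r c")
      case True
      then show ?thesis
        using cov by blast
    next
      case False
      \<comment> \<open>An isolated row is a component by itself, with vectors of dimension
        0.\<close>
      then show ?thesis
        unfolding covered_def factorable_def using t
        by (intro exI[of _ "{r}"] exI[of _ "{}"] conjI exI[of _ 0]) auto
    qed
    then obtain S0 T0 where S0: "r \<in> S0" and closed: "\<forall>r c. E r c \<longrightarrow> (r \<in> S0 \<longleftrightarrow> c \<in> T0)"
      and "factorable E t S0 T0"
      unfolding covered_def by blast
    then have "factorable E t (S \<inter> S0) (T \<inter> T0)"
      by (elim factorable_mono) auto
    moreover have "factorable E t (S - S0) (T - T0)"
      using r S0 by (intro psubset.IH) auto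
    ultimately have "factorable E t ((S \<inter> S0) \<union> (S - S0)) ((T \<inter> T0) \<union> (T - T0))"
      using closed by (intro factorable_Un[OF t]) auto
    then show ?thesis
      by (simp only: Int_Diff_Un)
  qed
qed

text \<open>The restriction to chosen rows and columns is moved from the graph to the contraction,
  which stays a contraction when rows and columns are set to zero.\<close>

lemma schur_lower_induced:
  assumes "schur_lower (\<lambda>r c. P r \<and> Q c \<and> E r c) t"
  shows "schur_lower E t"
proof -
  obtain p q \<rho> \<gamma> X v where inj: "inj_on \<rho> {..<p}" "inj_on \<gamma> {..<q}" and X: "contraction p q X"
    and v: "0 < (\<Sum>j<q. (v j)\<^sup>2)"
    and le: "t\<^sup>2 * (\<Sum>j<q. (v j)\<^sup>2)
      \<le> (\<Sum>i<p. (\<Sum>j<q. of_bool (P (\<rho> i) \<and> Q (\<gamma> j) \<and> E (\<rho> i) (\<gamma> j)) * X i j * v j)\<^sup>2)"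
    using assms unfolding schur_lower_def by blast
  define Y :: "nat \<Rightarrow> nat \<Rightarrow> real" where "Y i j = of_bool (P (\<rho> i)) * (of_bool (Q (\<gamma> j)) * X i j)" for i j
  have "contraction p q Y"
    unfolding contraction_def
  proof
    fix w
    have "(\<Sum>i<p. (\<Sum>j<q. Y i j * w j)\<^sup>2)
        = (\<Sum>i<p. of_bool (P (\<rho> i)) * (\<Sum>j<q. X i j * (of_bool (Q (\<gamma> j)) * w j))\<^sup>2)"
      by (intro sum.cong refl) (simp add: Y_def ac_simps)
    also have "\<dots> \<le> (\<Sum>i<p. (\<Sum>j<q. X i j * (of_bool (Q (\<gamma> j)) * w j))\<^sup>2)"
      by (intro sum_mono) simp
    also have "\<dots> \<le> (\<Sum>j<q. (of_bool (Q (\<gamma> j)) * w j)\<^sup>2)"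
      using X by (simp only: contraction_def)
    also have "\<dots> \<le> (\<Sum>j<q. (w j)\<^sup>2)"
      by (intro sum_mono) simp
    finally show "(\<Sum>i<p. (\<Sum>j<q. Y i j * w j)\<^sup>2) \<le> (\<Sum>j<q. (w j)\<^sup>2)" .
  qed
  moreover have "of_bool (P (\<rho> i) \<and> Q (\<gamma> j) \<and> E (\<rho> i) (\<gamma> j)) * X i j
      = of_bool (E (\<rho> i) (\<gamma> j)) * Y i j" for i j
    by (auto simp: Y_def)
  then have "t\<^sup>2 * (\<Sum>j<q. (v j)\<^sup>2) \<le> (\<Sum>i<p. (\<Sum>j<q. of_bool (E (\<rho> i) (\<gamma> j)) * Y i j * v j)\<^sup>2)"
    using le by (simp only:)
  ultimately show ?thesis
    unfolding schur_lower_def using inj v by blast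
qed

text \<open>Twins are collapsed by keeping only the least member of each twin class.\<close>

lemma norm_value_of_small_graph:
  fixes E :: "nat \<Rightarrow> nat \<Rightarrow> bool"
  assumes small: "\<not> schur_lower E \<eta>\<^sub>6" and edge: "E r0 c0"
  shows "\<exists>t\<in>{1, \<eta>\<^sub>2, \<eta>\<^sub>3, \<eta>\<^sub>4, \<eta>\<^sub>5}. schur_lower E t \<and> (\<forall>n. factorable E t {..<n} {..<n})"
proof -
  define f where "f r = (LEAST r'. E r' = E r)" for r
  define g where "g c = (LEAST c'. (\<lambda>r. E r c') = (\<lambda>r. E r c))" for c
  have f: "E (f r) = E r" for r
    unfolding f_def by (rule LeastI) simp
  have g: "(\<lambda>r. E r (g c)) = (\<lambda>r. E r c)" for c
    unfolding g_def by (rule LeastI) simp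
  have ff: "f r = f s" if "E r = E s" for r s
    unfolding f_def using that by simp
  have gg: "g c = g d" if "(\<lambda>r. E r c) = (\<lambda>r. E r d)" for c d
    unfolding g_def using that by simp
  define F where "F = (\<lambda>r c. f r = r \<and> g c = c \<and> E r c)"
  \<comment> \<open>Every vertex has the neighbourhood of its representative, so \<open>E\<close> is
    the pullback of \<open>F\<close> along \<open>f\<close> and \<open>g\<close>.\<close>
  have F: "F (f r) (g c) = E r c" for r c
    using f[of r] fun_cong[OF g[of c]] ff[OF f[of r]] gg[OF g[of c]] by (simp add: F_def)
  interpret small_graph F
  proof
    show "r = s" if "F r c" and eq: "\<And>d. F r d \<longleftrightarrow> F s d" for r s c
    proof -
      have least: "f r = r" "f s = s"
        using that(1) eq[of c] by (auto simp: F_def)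
      have "E r d = E s d" for d
        using F[of r d] F[of s d] eq[of "g d"] by (simp add: least)
      then show ?thesis
        using ff[of r s] least by auto
    qed
    show "c = d" if "F r c" and eq: "\<And>s. F s c \<longleftrightarrow> F s d" for r c d
    proof -
      have least: "g c = c" "g d = d"
        using that(1) eq[of r] by (auto simp: F_def)
      have "E s c = E s d" for s
        using F[of s c] F[of s d] eq[of "f s"] by (simp add: least)
      then show ?thesis
        using gg[of c d] least by auto
    qed
    show "\<not> schur_lower F \<eta>\<^sub>6"
      using small schur_lower_induced[of "\<lambda>r. f r = r" "\<lambda>c. g c = c" E] unfolding F_def by blast
  qed
  \<comment> \<open>These are the values established as lower bounds for \<open>F\<close>. The value
    of every component lies in \<open>L\<close>, so the maximum is an upper bound for all components
    and a lower bound for \<open>F\<close>.\<close>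
  define L where "L = {t \<in> {1, \<eta>\<^sub>2, \<eta>\<^sub>3, \<eta>\<^sub>4, \<eta>\<^sub>5}. schur_lower F t}"
  have "finite L"
    unfolding L_def by (rule finite_Collect_conjI) (simp only: Collect_mem_eq finite_insert finite.emptyI simp_thms)
  moreover have "L \<noteq> {}"
    using row_covered[of "f r0" "g c0"] edge unfolding F L_def by blast
  ultimately have Max: "Max L \<in> L"
    by (rule Max_in)
  have "\<forall>t\<in>{1, \<eta>\<^sub>2, \<eta>\<^sub>3, \<eta>\<^sub>4, \<eta>\<^sub>5}. 0 \<le> t"
    by simp
  then have "0 \<le> Max L"
    using Max unfolding L_def by blast
  have "covered F r (Max L)" if Frc: "F r c" for r c
  proof -
    obtain t where "t \<in> L" "covered F r t"
      using row_covered[OF Frc] unfolding L_def by blast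
    moreover have "t \<le> Max L"
      using \<open>finite L\<close> \<open>t \<in> L\<close> by (rule Max_ge)
    ultimately show ?thesis
      unfolding covered_def using factorable_mono[OF _ \<open>t \<le> Max L\<close> subset_refl subset_refl] by blast
  qed
  then have "factorable F (Max L) (f ` {..<n}) (g ` {..<n})" for n
    using \<open>0 \<le> Max L\<close> by (intro factorable_finite) auto
  then have "factorable E (Max L) {..<n} {..<n}" for n
    using factorable_vimage[of F "Max L" f "{..<n}" g "{..<n}"] by (simp add: F)
  moreover have "schur_lower E (Max L)"
    using Max schur_lower_induced[of "\<lambda>r. f r = r" "\<lambda>c. g c = c" E] unfolding L_def F_def by blast
  ultimately show ?thesis
    using Max unfolding L_def by blast
qed

section \<open>From graphs to the set of norms\<close>

lemma schur_norm_eq: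
  fixes A :: "nat \<Rightarrow> nat \<Rightarrow> 'a::{real_normed_field, euclidean_space}"
  assumes "\<And>i j. A i j = of_bool (E i j)" "0 \<le> t" "schur_lower E t"
    and "\<And>n. factorable E t {..<n} {..<n}"
  shows "schur_norm A = ereal t"
proof (rule antisym)
  show "schur_norm A \<le> ereal t"
    unfolding schur_norm_def using assms schur_norm_fin_le_factorable[of A E t] by (intro SUP_least) simp
  show "ereal t \<le> schur_norm A"
    using assms by (intro schur_lower_le_schur_norm)
qed

text \<open>One column supports a nonzero test vector, and with no rows the estimate reads 0 at most
  0.\<close>

lemma schur_lower_zero: "schur_lower E 0"
  unfolding schur_lower_def
  by (intro exI[of _ 0] exI[of _ 1] exI[of _ id] exI[of _ "\<lambda>_. undefined"] exI[of _ "\<lambda>_ _. 0"] exI[of _ "\<lambda>_. 1"])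
    (auto simp: contraction_def inj_on_def)

lemma idem_schur_normsI:
  fixes E :: "nat \<Rightarrow> nat \<Rightarrow> bool"
  assumes "0 \<le> t" "schur_lower E t" "\<And>n. factorable E t {..<n} {..<n}"
  shows "t \<in> idem_schur_norms TYPE('a::{real_normed_field, euclidean_space})"
proof -
  have "schur_norm (\<lambda>i j. of_bool (E i j) :: 'a) = ereal t"
    using assms by (intro schur_norm_eq) auto
  then show ?thesis
    unfolding idem_schur_norms_def
    by (intro CollectI exI[of _ "\<lambda>i j. of_bool (E i j) :: 'a"]) auto
qed

lemma idem_schur_norms_rowsI:
  fixes E :: "nat \<Rightarrow> nat \<Rightarrow> bool"
  assumes "0 \<le> t" "schur_lower E t" "\<And>T. factorable E t R T" "\<And>r c. r \<notin> R \<Longrightarrow> \<not> E r c"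
  shows "t \<in> idem_schur_norms TYPE('a::{real_normed_field, euclidean_space})"
  using assms(1,2) by (rule idem_schur_normsI) (rule factorable_isolated_rows[OF assms(1,3,4)])

lemma \<eta>_in_idem_schur_norms:
  "{0, 1, \<eta>\<^sub>2, \<eta>\<^sub>3, \<eta>\<^sub>4, \<eta>\<^sub>5, \<eta>\<^sub>6} \<subseteq> idem_schur_norms TYPE('a::{real_normed_field, euclidean_space})"
proof -
  \<comment> \<open>Adjacency lists: \<open>rs ! i\<close> holds the columns met by row
    \<open>i\<close>, and all later rows of the infinite matrix are zero.\<close>
  let ?E = "\<lambda>rs (i::nat) (j::nat). i < length rs \<and> j \<in> set (rs ! i)"
  have "0 \<in> idem_schur_norms TYPE('a)"
    by (rule idem_schur_norms_rowsI[of 0 "\<lambda>_ _. False" "{}"])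
      (auto simp: schur_lower_zero factorable_empty)
  moreover have "1 \<in> idem_schur_norms TYPE('a)"
    by (rule idem_schur_norms_rowsI[of 1 "?E [[0]]" "{0}"])
      (auto intro: schur_lower_edge[of _ 0 0] factorable_one_row)
  moreover have "\<eta>\<^sub>2 \<in> idem_schur_norms TYPE('a)"
  proof (rule idem_schur_norms_rowsI[of _ "?E [[0, 1], [1]]" "{0, 1}"])
    show "schur_lower (?E [[0, 1], [1]]) \<eta>\<^sub>2"
      by (rule schur_lower_P4[of _ 0 0 1 1]) auto
  qed (auto intro: factorable_two_rows)
  moreover have "\<eta>\<^sub>3 \<in> idem_schur_norms TYPE('a)"
  proof (rule idem_schur_norms_rowsI[of _ "?E [[0, 1], [1, 2], [2]]" "{0, 1, 2}"])
    show "schur_lower (?E [[0, 1], [1, 2], [2]]) \<eta>\<^sub>3"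
      by (rule schur_lower_P6[of _ 0 0 1 2 1 2]) auto
    show "factorable (?E [[0, 1], [1, 2], [2]]) \<eta>\<^sub>3 {0, 1, 2} T" for T
      by (rule factorable_three_rows_path) auto
  qed auto
  moreover have "\<eta>\<^sub>4 \<in> idem_schur_norms TYPE('a)"
  proof (rule idem_schur_norms_rowsI[of _ "?E [[2], [1], [0, 1, 2]]" "{2, 0, 1}"])
    show "schur_lower (?E [[2], [1], [0, 1, 2]]) \<eta>\<^sub>4"
      by (rule schur_lower_spider_122[of _ 0 0 1 2 1 2]) auto
    show "factorable (?E [[2], [1], [0, 1, 2]]) \<eta>\<^sub>4 {2, 0, 1} T" for T
      by (rule factorable_three_rows_spider_133) auto
  qed auto
  moreover have "\<eta>\<^sub>5 \<in> idem_schur_norms TYPE('a)"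
  proof (rule idem_schur_norms_rowsI[of _ "?E [[0, 3], [1, 3], [2, 3]]" "{0, 1, 2}"])
    \<comment> \<open>Column 3 is the centre, so that three rows carry the graph; the certificate
      has its centre among the rows and is transposed.\<close>
    have "schur_lower (\<lambda>c r. ?E [[0, 3], [1, 3], [2, 3]] r c) \<eta>\<^sub>5"
      by (rule schur_lower_spider_222[of _ 0 0 1 2 1 2 3]) auto
    then show "schur_lower (?E [[0, 3], [1, 3], [2, 3]]) \<eta>\<^sub>5"
      by (rule schur_lower_transp) simp
    show "factorable (?E [[0, 3], [1, 3], [2, 3]]) \<eta>\<^sub>5 {0, 1, 2} T" for T
      by (rule factorable_three_rows_spider_222) auto
  qed auto
  moreover have "\<eta>\<^sub>6 \<in> idem_schur_norms TYPE('a)"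
  proof (rule idem_schur_norms_rowsI[of _ "?E [[0, 1], [1, 2], [2, 3], [3]]" "{0, 1, 2, 3}"])
    show "schur_lower (?E [[0, 1], [1, 2], [2, 3], [3]]) \<eta>\<^sub>6"
      by (rule schur_lower_P8[of _ 0 0 1 2 3 1 2 3]) auto
    show "factorable (?E [[0, 1], [1, 2], [2, 3], [3]]) \<eta>\<^sub>6 {0, 1, 2, 3} T" for T
      by (rule factorable_four_rows_P8) auto
  qed auto
  ultimately show ?thesis
    by blast
qed

lemma idem_schur_norms_subset:
  "idem_schur_norms TYPE('a::{real_normed_field, euclidean_space})
    \<subseteq> {0, 1, \<eta>\<^sub>2, \<eta>\<^sub>3, \<eta>\<^sub>4, \<eta>\<^sub>5} \<union> {\<eta>\<^sub>6..}"
proof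
  fix x assume "x \<in> idem_schur_norms TYPE('a)"
  then obtain A :: "nat \<Rightarrow> nat \<Rightarrow> 'a" where x: "x = real_of_ereal (schur_norm A)"
    and A01: "\<forall>i j. A i j \<in> {0, 1}" and fin: "schur_norm A < \<infinity>"
    unfolding idem_schur_norms_def by blast
  define E where "E i j \<longleftrightarrow> A i j = 1" for i j
  have A: "A i j = of_bool (E i j)" for i j
    using A01 by (auto simp: E_def of_bool_def)
  consider "\<forall>i j. \<not> E i j" | "schur_lower E \<eta>\<^sub>6" | i j where "E i j" "\<not> schur_lower E \<eta>\<^sub>6"
    by blast
  then show "x \<in> {0, 1, \<eta>\<^sub>2, \<eta>\<^sub>3, \<eta>\<^sub>4, \<eta>\<^sub>5} \<union> {\<eta>\<^sub>6..}"
  proof cases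
    case 1
    then have "factorable E 0 {..<n} {..<n}" for n
      using factorable_isolated_rows[OF _ factorable_empty, of 0 E] by auto
    then have "schur_norm A = ereal 0"
      by (intro schur_norm_eq[of A E] A schur_lower_zero) auto
    then show ?thesis
      by (simp add: x)
  next
    case 2
    have "0 \<le> \<eta>\<^sub>6"
      by simp
    then have "ereal \<eta>\<^sub>6 \<le> schur_norm A"
      using schur_lower_le_schur_norm[of A E "\<eta>\<^sub>6"] A 2 by blast
    then have "\<eta>\<^sub>6 \<le> x"
      using fin unfolding x by (cases "schur_norm A") auto
    then show ?thesis
      by (simp only: Un_iff atLeast_iff simp_thms)
  next
    case 3
    then obtain t where t: "t \<in> {1, \<eta>\<^sub>2, \<eta>\<^sub>3, \<eta>\<^sub>4, \<eta>\<^sub>5}" "schur_lower E t" "\<forall>n. factorable E t {..<n} {..<n}"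
      using norm_value_of_small_graph by blast
    have "\<forall>t\<in>{1, \<eta>\<^sub>2, \<eta>\<^sub>3, \<eta>\<^sub>4, \<eta>\<^sub>5}. 0 \<le> t"
      by simp
    then have "0 \<le> t"
      using t(1) by blast
    then have "schur_norm A = ereal t"
      using t by (intro schur_norm_eq[of A E] A) auto
    then have "x = t"
      by (simp add: x)
    then show ?thesis
      using t(1) by blast
  qed
qed

theorem theorem1p1:
  shows "(let \<eta>\<^sub>6 = (2/5) * sqrt (5 + 2 * sqrt 5);
              E = {0, 1, sqrt (4/3), (1 + sqrt 2) / 2, (1/15) * sqrt (169 + 38 * sqrt 19),
                   sqrt (3/2)}
          in (E \<union> {\<eta>\<^sub>6} \<subseteq> idem_schur_norms TYPE(real) \<and>
              idem_schur_norms TYPE(real) \<subseteq> E \<union> {\<eta>\<^sub>6..}) \<and>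
             (E \<union> {\<eta>\<^sub>6} \<subseteq> idem_schur_norms TYPE(complex) \<and>
              idem_schur_norms TYPE(complex) \<subseteq> E \<union> {\<eta>\<^sub>6..}))"
  unfolding Let_def
  using \<eta>_in_idem_schur_norms[where 'a = real] \<eta>_in_idem_schur_norms[where 'a = complex]
    idem_schur_norms_subset[where 'a = real] idem_schur_norms_subset[where 'a = complex]
  by (simp only: Un_insert_left sup_bot_left)

end
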